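(* Let $H$ be a forest whose connected components are the trees $T_1,\dots,T_k$, and let $b$ be a positive integer. (1) If $H$ is a tree ($k=1$), then there exists a tree $T$ such that Maker, moving first, wins the $(1:b)$ Maker-Breaker vertex $H$-game played on $T$. (2) For $1\le i\le k$ let $T^{(i)}_{\min}$ be a tree with the minimum number of vertices such that Maker, moving first, wins the $(1:b)$ Maker-Breaker vertex $T_i$-game played on $T^{(i)}_{\min}$, and let $T_{\max}$ be one of the trees $T^{(i)}_{\min}$ with the maximum number of vertices. Write $v=v(T_{\max})$, $e=e(T_{\max})$. Then for $G\sim G(n,p)$: if $p=\omega(n^{-v/e})$ then w.h.p. Maker wins the $(1:b)$ Maker-Breaker vertex $H$-game on $G$, and if $p=o(n^{-v/e})$ then w.h.p. Breaker wins it (in both cases regardless of which player moves first).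
   Context: $G(n,p)$ is the binomial random graph; "w.h.p." means with probability tending to $1$ as $n\to\infty$. For graphs $G,H$ and a positive integer $b$, the $(1:b)$ Maker-Breaker vertex $H$-game on $G$ is played as follows: Maker and Breaker alternately claim previously unclaimed vertices of $G$, Maker claiming one vertex per turn and Breaker claiming $b$ vertices per turn (the last player may claim fewer if not enough free vertices remain), until all vertices are claimed. Maker wins if the subgraph of $G$ induced by the set of vertices he claimed contains a (not necessarily induced) copy of $H$; otherwise Breaker wins.
   Formalization: In part (2) the forest H is assumed to have at least one edge; for an edgeless H the tree T_max is a single vertex (or does not exist), so e = 0 and the threshold n^{-v/e} is undefined. *)

theory Defs
  imports "HOL-Probability.Probability" "HOL-Library.Landau_Symbols"
begin

definition graph :: "'a set \<Rightarrow> 'a set set \<Rightarrow> bool" where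
  "graph V E \<longleftrightarrow> finite V \<and> (\<forall>e\<in>E. \<exists>x y. x \<noteq> y \<and> x \<in> V \<and> y \<in> V \<and> e = {x, y})"

definition reach :: "'a set set \<Rightarrow> 'a \<Rightarrow> 'a \<Rightarrow> bool" where
  "reach E = (\<lambda>u w. {u, w} \<in> E)\<^sup>*\<^sup>*"

definition connected_graph :: "'a set \<Rightarrow> 'a set set \<Rightarrow> bool" where
  "connected_graph V E \<longleftrightarrow> V \<noteq> {} \<and> (\<forall>x\<in>V. \<forall>y\<in>V. reach E x y)"

definition has_cycle :: "'a set \<Rightarrow> 'a set set \<Rightarrow> bool" where
  "has_cycle V E \<longleftrightarrow> (\<exists>xs. length xs \<ge> 3 \<and> distinct xs \<and> set xs \<subseteq> V \<and>
      (\<forall>i < length xs. {xs ! i, xs ! ((i + 1) mod length xs)} \<in> E))"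

definition tree :: "'a set \<Rightarrow> 'a set set \<Rightarrow> bool" where
  "tree V E \<longleftrightarrow> graph V E \<and> connected_graph V E \<and> \<not> has_cycle V E"

definition forest :: "'a set \<Rightarrow> 'a set set \<Rightarrow> bool" where
  "forest V E \<longleftrightarrow> graph V E \<and> \<not> has_cycle V E"

definition components :: "'a set \<Rightarrow> 'a set set \<Rightarrow> 'a set set" where
  "components V E = {C. \<exists>x\<in>V. C = {y \<in> V. reach E x y}}"

definition induced_edges :: "'a set set \<Rightarrow> 'a set \<Rightarrow> 'a set set" where
  "induced_edges E C = {e \<in> E. e \<subseteq> C}"

definition has_copy :: "'a set set \<Rightarrow> 'b set \<Rightarrow> 'b set set \<Rightarrow> 'a set \<Rightarrow> bool" where
  "has_copy E VH EH M \<longleftrightarrow> (\<exists>f. inj_on f VH \<and> f ` VH \<subseteq> M \<and>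
      (\<forall>x y. {x, y} \<in> EH \<longrightarrow> {f x, f y} \<in> E))"

text \<open>Positions: M = Maker's vertices, B = Breaker's vertices, flag mt = it is
  Maker's turn. maker_win: Maker has a winning strategy from the position.\<close>
inductive maker_win :: "'a set \<Rightarrow> 'a set set \<Rightarrow> 'b set \<Rightarrow> 'b set set \<Rightarrow> nat \<Rightarrow> bool \<Rightarrow> 'a set \<Rightarrow> 'a set \<Rightarrow> bool"
  for V E VH EH b where
  mw_end: "V - (M \<union> B) = {} \<Longrightarrow> has_copy E VH EH M \<Longrightarrow> maker_win V E VH EH b mt M B"
| mw_maker: "v \<in> V - (M \<union> B) \<Longrightarrow> maker_win V E VH EH b False (insert v M) B
      \<Longrightarrow> maker_win V E VH EH b True M B"
| mw_breaker: "V - (M \<union> B) \<noteq> {} \<Longrightarrow>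
      (\<forall>S. S \<subseteq> V - (M \<union> B) \<and> card S = min b (card (V - (M \<union> B)))
            \<longrightarrow> maker_win V E VH EH b True M (B \<union> S))
      \<Longrightarrow> maker_win V E VH EH b False M B"

inductive breaker_win :: "'a set \<Rightarrow> 'a set set \<Rightarrow> 'b set \<Rightarrow> 'b set set \<Rightarrow> nat \<Rightarrow> bool \<Rightarrow> 'a set \<Rightarrow> 'a set \<Rightarrow> bool"
  for V E VH EH b where
  bw_end: "V - (M \<union> B) = {} \<Longrightarrow> \<not> has_copy E VH EH M \<Longrightarrow> breaker_win V E VH EH b mt M B"
| bw_maker: "V - (M \<union> B) \<noteq> {} \<Longrightarrow>
      (\<forall>v \<in> V - (M \<union> B). breaker_win V E VH EH b False (insert v M) B)
      \<Longrightarrow> breaker_win V E VH EH b True M B"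
| bw_breaker: "V - (M \<union> B) \<noteq> {} \<Longrightarrow> S \<subseteq> V - (M \<union> B) \<Longrightarrow>
      card S = min b (card (V - (M \<union> B))) \<Longrightarrow> breaker_win V E VH EH b True M (B \<union> S)
      \<Longrightarrow> breaker_win V E VH EH b False M B"

definition maker_wins_game :: "'a set \<Rightarrow> 'a set set \<Rightarrow> 'b set \<Rightarrow> 'b set set \<Rightarrow> nat \<Rightarrow> bool \<Rightarrow> bool" where
  "maker_wins_game V E VH EH b maker_first = maker_win V E VH EH b maker_first {} {}"

definition breaker_wins_game :: "'a set \<Rightarrow> 'a set set \<Rightarrow> 'b set \<Rightarrow> 'b set set \<Rightarrow> nat \<Rightarrow> bool \<Rightarrow> bool" where
  "breaker_wins_game V E VH EH b maker_first = breaker_win V E VH EH b maker_first {} {}"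

definition all_edges :: "nat \<Rightarrow> nat set set" where
  "all_edges n = {e. \<exists>i j. i < j \<and> j < n \<and> e = {i, j}}"

definition gnp :: "nat \<Rightarrow> real \<Rightarrow> nat set set pmf" where
  "gnp n p = map_pmf (\<lambda>f. {e \<in> all_edges n. f e})
                (Pi_pmf (all_edges n) False (\<lambda>_. bernoulli_pmf p))"

definition whp :: "(nat \<Rightarrow> real) \<Rightarrow> (nat \<Rightarrow> nat set set \<Rightarrow> bool) \<Rightarrow> bool" where
  "whp p P \<longleftrightarrow> (\<lambda>n. measure_pmf.prob (gnp n (p n)) {E. P n E}) \<longlonglongrightarrow> 1"

end

theory Submission
  imports Defs
begin

text \<open>On a tree in which every inner vertex has more than \<open>(b + 1) * v(H)\<close> children, Maker can embed
  the tree \<open>H\<close> greedily, since Breaker can never block all children of a vertex.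

  Let \<open>v\<close> and \<open>e = v - 1\<close> be the parameters of the largest minimal tree. A disjoint union \<open>F\<close> of trees with at
  most \<open>v\<close> vertices has density at most \<open>e / v\<close> in all its subgraphs, so above the threshold the second
  moment method yields a copy of \<open>F\<close> in the random graph. Let \<open>F\<close> consist of many copies of every minimal
  tree. Maker builds the components of \<open>H\<close> one at a time, each in an untouched copy of the corresponding
  minimal tree: the number of his moves is bounded, so Breaker cannot spoil all copies.

  Below the threshold a first moment estimate shows that all components of the random graph are trees
  with fewer than \<open>v\<close> vertices. By minimality Maker, moving first, does not win the game for the decisive
  component of \<open>H\<close> on any of them, so Breaker answers every move in the component where it was made.\<close>

section \<open>Trees and forests\<close>

text \<open>Breaker must claim exactly \<open>b\<close> vertices whenever so many are free, so
  neither player's strategy on a piece of the board transfers verbatim to the whole board. On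
  Maker's side the relaxed game \<open>forces\<close> lets Breaker claim fewer; its round counter
  also bounds how many vertices Breaker owns when Maker turns to the next component. On Breaker's
  side the invariant keeps, for every component, a subset of his vertices from which Maker is
  already lost, so surplus vertices can be claimed anywhere.

  Trees enter the probability estimates only through edge counts. In a forest \<open>s > 0\<close>
  vertices span \<open>k < s\<close> edges, and \<open>s <= e + 1\<close> then makes
  \<open>(e + 1) * k <= e * s\<close>, which is the density bound. Below the threshold
  \<open>n^v * p^e\<close> and, since \<open>v / e > 1\<close>, also \<open>n * p\<close> tend to 0:
  the first limit excludes connected sets of \<open>v\<close> vertices, the second excludes cycles
  shorter than \<open>v\<close>. The exponent \<open>v / e\<close> is meaningful because
  \<open>EH\<close> has an edge, which forces \<open>e > 0\<close>.\<close>

lemma graph_edgeD: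
  assumes "graph V E" "{x, y} \<in> E"
  shows "x \<in> V" "y \<in> V" "x \<noteq> y"
proof -
  obtain a c where "a \<noteq> c" "a \<in> V" "c \<in> V" "{x, y} = {a, c}"
    using assms unfolding graph_def by blast
  then show "x \<in> V" "y \<in> V" "x \<noteq> y" by (auto simp: doubleton_eq_iff)
qed

lemma graph_finite_edges:
  assumes "graph V E"
  shows "finite E"
proof (rule finite_subset)
  show "E \<subseteq> Pow V" using assms by (auto simp: graph_def)
  show "finite (Pow V)" using assms by (simp add: graph_def)
qed

lemma finite_induced_edges: "finite W \<Longrightarrow> finite (induced_edges E W)"
  by (rule finite_subset[of _ "Pow W"]) (auto simp: induced_edges_def)

lemma graph_edge_cases:
  assumes "graph V E" "e \<in> E" "x \<in> e"
  obtains y where "e = {x, y}" "x \<noteq> y"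
  using assms unfolding graph_def by (metis doubleton_eq_iff insert_iff singletonD)

text \<open>An end \<open>x\<close> of a longest path inside \<open>S\<close> works: by maximality
  all its neighbours in \<open>S\<close> lie on the path, and one other than its successor would
  close a cycle.\<close>

lemma acyclic_low_degree_vertex:
  assumes g: "graph V E" and nc: "\<not> has_cycle V E" and S: "S \<subseteq> V" "S \<noteq> {}"
  shows "\<exists>x\<in>S. card {e \<in> E. x \<in> e \<and> e \<subseteq> S} \<le> 1"
proof -
  define P where "P xs \<longleftrightarrow> distinct xs \<and> set xs \<subseteq> S \<and> xs \<noteq> [] \<and>
    (\<forall>i. Suc i < length xs \<longrightarrow> {xs ! i, xs ! Suc i} \<in> E)" for xs
  have finS: "finite S" using g S finite_subset by (auto simp: graph_def)
  obtain s where "s \<in> S" using S by auto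
  then have "P [s]" by (auto simp: P_def)
  moreover have "\<And>xs. P xs \<Longrightarrow> length xs < Suc (card S)"
    unfolding P_def by (metis card_mono distinct_card finS le_imp_less_Suc)
  ultimately obtain xs where xs: "P xs" and mx: "\<And>ys. P ys \<Longrightarrow> length ys \<le> length xs"
    using ex_has_greatest_nat[of P "[s]" length "Suc (card S)"] by (meson less_imp_le)
  define x where "x = xs ! 0"
  have len: "length xs > 0" using xs by (auto simp: P_def)
  have xS: "x \<in> S" using xs len unfolding P_def x_def by (meson nth_mem subsetD)
  have nb: "\<exists>k. 0 < k \<and> k < length xs \<and> xs ! k = y" if y: "{x, y} \<in> E" "y \<in> S" for y
  proof -
    have ne: "x \<noteq> y" using graph_edgeD(3)[OF g y(1)] .
    have "y \<in> set xs"
    proof (rule ccontr)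
      assume "y \<notin> set xs"
      then have "P (y # xs)"
        using xs y unfolding P_def x_def
        by (auto simp: nth_Cons insert_commute split: nat.splits)
      then show False using mx by fastforce
    qed
    then obtain k where "k < length xs" "xs ! k = y" by (auto simp: in_set_conv_nth)
    then show ?thesis using ne by (intro exI[of _ k]) (auto simp: x_def intro: gr0I)
  qed
  \<comment> \<open>This edge would close the initial segment up to \<open>xs ! k\<close> to a
    cycle; \<open>2 <= k\<close> gives it the three vertices that \<open>has_cycle\<close> asks
    for.\<close>
  have no: "\<not> {x, xs ! k} \<in> E" if k: "2 \<le> k" "k < length xs" for k
  proof
    assume e: "{x, xs ! k} \<in> E"
    define ys where "ys = take (Suc k) xs"
    have ly: "length ys = Suc k" using k by (simp add: ys_def)
    have "{ys ! i, ys ! ((i + 1) mod length ys)} \<in> E" if "i < length ys" for i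
    proof (cases "i = k")
      case True
      then show ?thesis using e ly by (auto simp: ys_def x_def insert_commute)
    next
      case False
      then have "i < k" using that ly by simp
      then show ?thesis using xs k ly by (auto simp: P_def ys_def)
    qed
    moreover have "distinct ys" "set ys \<subseteq> V"
      using xs S set_take_subset[of "Suc k" xs] by (auto simp: ys_def P_def)
    ultimately have "has_cycle V E"
      unfolding has_cycle_def using ly k by (intro exI[of _ ys]) auto
    then show False using nc by simp
  qed
  have "e1 = e2" if "e1 \<in> {e \<in> E. x \<in> e \<and> e \<subseteq> S}" "e2 \<in> {e \<in> E. x \<in> e \<and> e \<subseteq> S}" for e1 e2
  proof -
    have *: "e = {x, xs ! 1}" if e: "e \<in> E" "x \<in> e" "e \<subseteq> S" for e
    proof -
      obtain y where y: "e = {x, y}" using graph_edge_cases[OF g e(1,2)] .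
      then obtain k where k: "0 < k" "k < length xs" "xs ! k = y" using nb[of y] e by auto
      then have "k = 1" using no[of k] y e by (cases "k = 1") auto
      then show ?thesis using k y by simp
    qed
    show ?thesis using *[of e1] *[of e2] that by auto
  qed
  then have "card {e \<in> E. x \<in> e \<and> e \<subseteq> S} \<le> Suc 0"
    using graph_finite_edges[OF g] by (subst card_le_Suc0_iff_eq) auto
  then show ?thesis using xS by auto
qed

text \<open>Delete a vertex of degree at most one and induct. In this counting form acyclicity
  serves both the greedy embedding and the density bound.\<close>

lemma acyclic_card_edges:
  assumes g: "graph V E" and nc: "\<not> has_cycle V E" and "S \<subseteq> V" "S \<noteq> {}"
  shows "card (induced_edges E S) < card S"
  using assms(3,4)
proof (induction "card S" arbitrary: S rule: less_induct)
  case less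
  have finS: "finite S" using g less.prems finite_subset by (auto simp: graph_def)
  obtain x where x: "x \<in> S" "card {e \<in> E. x \<in> e \<and> e \<subseteq> S} \<le> 1"
    using acyclic_low_degree_vertex[OF g nc less.prems] by auto
  have eq: "induced_edges E S = induced_edges E (S - {x}) \<union> {e \<in> E. x \<in> e \<and> e \<subseteq> S}"
    by (auto simp: induced_edges_def)
  show ?case
  proof (cases "S = {x}")
    case True
    have "e \<notin> induced_edges E S" for e
      using True g by (auto simp: induced_edges_def graph_def)
    then have "induced_edges E S = {}" by auto
    then show ?thesis using True by simp
  next
    case False
    have c: "card (S - {x}) < card S" using x finS by (meson card_Diff1_less)
    have "card (induced_edges E (S - {x})) < card (S - {x})"
      using less.hyps[OF c] less.prems False x by auto
    moreover have "card (induced_edges E S) \<le> card (induced_edges E (S - {x})) + 1"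
      unfolding eq using x(2) card_Un_le le_trans add_left_mono by meson
    moreover have "card (S - {x}) = card S - 1" using x by simp
    ultimately show ?thesis using c by linarith
  qed
qed

lemma reach_crossing_edge:
  assumes "reach E x y" "x \<in> W" "y \<notin> W"
  shows "\<exists>u w. {u, w} \<in> E \<and> u \<in> W \<and> w \<notin> W \<and> reach E x w"
  using assms unfolding reach_def
proof (induction rule: rtranclp_induct)
  case (step y z)
  show ?case
  proof (cases "y \<in> W")
    case True
    then show ?thesis using step by (meson rtranclp.rtrancl_into_rtrancl)
  next
    case False
    then show ?thesis using step by auto
  qed
qed simp

text \<open>Each edge that leaves \<open>W\<close> inside the component adds one vertex and at least
  one induced edge. Growth can stop at any size: \<open>k = card K\<close> counts the edges of a
  tree, \<open>k = v\<close> produces the set that the first moment estimate excludes.\<close>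

lemma component_grow:
  assumes g: "graph V E" and x: "x \<in> V" and K: "K = {y \<in> V. reach E x y}"
    and k: "0 < k" "k \<le> card K"
  shows "\<exists>W\<subseteq>K. x \<in> W \<and> card W = k \<and> k \<le> Suc (card (induced_edges E W))"
  using k
proof (induction k)
  case (Suc k)
  show ?case
  proof (cases "k = 0")
    case True
    have "x \<in> K" using x K by (auto simp: reach_def)
    then show ?thesis using True by (intro exI[of _ "{x}"]) auto
  next
    case False
    then obtain W where W: "W \<subseteq> K" "x \<in> W" "card W = k" "k \<le> Suc (card (induced_edges E W))"
      using Suc by auto
    have finK: "finite K" using g K by (auto simp: graph_def)
    have "W \<noteq> K" using W Suc by auto
    then obtain y where y: "y \<in> K" "y \<notin> W" using W by auto
    then obtain u w where uw: "{u, w} \<in> E" "u \<in> W" "w \<notin> W" "reach E x w"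
      using reach_crossing_edge[of E x y W] W K by auto
    have wK: "w \<in> K" using uw K graph_edgeD[OF g uw(1)] by auto
    have finW: "finite W" using W finK finite_subset by auto
    have "insert {u, w} (induced_edges E W) \<subseteq> induced_edges E (insert w W)"
      using uw by (auto simp: induced_edges_def)
    then have "card (insert {u, w} (induced_edges E W)) \<le> card (induced_edges E (insert w W))"
      using finW by (intro card_mono finite_induced_edges) auto
    moreover have "{u, w} \<notin> induced_edges E W" using uw by (auto simp: induced_edges_def)
    ultimately have "Suc (card (induced_edges E W)) \<le> card (induced_edges E (insert w W))"
      using finite_induced_edges[OF finW] by simp
    then show ?thesis using W wK uw finW by (intro exI[of _ "insert w W"]) auto
  qed
qed simp

lemma induced_edges_self: "graph V E \<Longrightarrow> induced_edges E V = E"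
  by (auto simp: graph_def induced_edges_def)

text \<open>Growing to all of \<open>V\<close> gives at least \<open>card V - 1\<close> edges, and
  acyclicity gives at most that many.\<close>

lemma tree_card_edges:
  assumes "tree V E"
  shows "card V = Suc (card E)"
proof -
  have g: "graph V E" "\<not> has_cycle V E" and c: "connected_graph V E" using assms by (auto simp: tree_def)
  obtain x where x: "x \<in> V" using c by (auto simp: connected_graph_def)
  have K: "V = {y \<in> V. reach E x y}" using c x by (auto simp: connected_graph_def)
  have fin: "finite V" using g by (auto simp: graph_def)
  have "0 < card V" using x fin by (auto simp: card_gt_0_iff)
  then obtain W where W: "W \<subseteq> V" "card W = card V" "card V \<le> Suc (card (induced_edges E W))"
    using component_grow[OF g(1) x K, of "card V"] by auto
  then have "W = V" using fin by (simp add: card_subset_eq)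
  then show ?thesis
    using W acyclic_card_edges[OF g, of V] x induced_edges_self[OF g(1)] by fastforce
qed

section \<open>Components as trees, and the edge count of a cycle\<close>

lemma reach_sym: "reach E x y \<Longrightarrow> reach E y x"
proof -
  have "symp (\<lambda>u w. {u, w} \<in> E)" by (auto simp: symp_def insert_commute)
  then show "reach E x y \<Longrightarrow> reach E y x"
    unfolding reach_def by (meson symp_rtranclp sympD)
qed

lemma reach_trans: "reach E x y \<Longrightarrow> reach E y z \<Longrightarrow> reach E x z"
  unfolding reach_def by simp

lemma reach_edge: "{x, y} \<in> E \<Longrightarrow> reach E x y"
  unfolding reach_def by auto

lemma component_reach_induced:
  assumes g: "graph V E" and K: "K = {y \<in> V. reach E x y}" and "x \<in> V" "reach E x y"
  shows "reach (induced_edges E K) x y"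
  using assms(4) unfolding reach_def
proof (induction rule: rtranclp_induct)
  case (step y z)
  have "y \<in> K" "z \<in> K"
    using step K graph_edgeD[OF g, of y z]
    by (auto simp: reach_def intro: rtranclp.rtrancl_into_rtrancl)
  then have "{y, z} \<in> induced_edges E K" using step by (auto simp: induced_edges_def)
  then show ?case using step.IH by (rule rtranclp.rtrancl_into_rtrancl[rotated])
qed auto

text \<open>Minimality of \<open>v\<close> speaks about trees as boards, so a component has to be a
  tree in its own right; in particular its vertices must be joined by its own edges.\<close>

lemma component_tree:
  assumes g: "graph V E" and nc: "\<not> has_cycle V E" and x: "x \<in> V" and K: "K = {y \<in> V. reach E x y}"
  shows "tree K (induced_edges E K)"
proof -
  have "graph K (induced_edges E K)"
    unfolding graph_def
  proof (intro conjI ballI)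
    show "finite K" using g K by (auto simp: graph_def)
    fix e assume "e \<in> induced_edges E K"
    then show "\<exists>x y. x \<noteq> y \<and> x \<in> K \<and> y \<in> K \<and> e = {x, y}"
      using g unfolding graph_def induced_edges_def by fastforce
  qed
  moreover have "connected_graph K (induced_edges E K)"
    unfolding connected_graph_def
  proof (intro conjI ballI)
    show "K \<noteq> {}" using x K by (auto simp: reach_def)
    fix y z assume "y \<in> K" "z \<in> K"
    then have "reach E x y" "reach E x z" using K by auto
    then show "reach (induced_edges E K) y z"
      by (rule reach_trans[OF reach_sym[OF component_reach_induced[OF g K x]] component_reach_induced[OF g K x]])
  qed
  moreover have "\<not> has_cycle K (induced_edges E K)"
  proof
    assume "has_cycle K (induced_edges E K)"
    then obtain xs where "3 \<le> length xs" "distinct xs" "set xs \<subseteq> K"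
      "\<forall>i < length xs. {xs ! i, xs ! ((i + 1) mod length xs)} \<in> induced_edges E K"
      unfolding has_cycle_def by blast
    then have "has_cycle V E"
      using K unfolding has_cycle_def by (intro exI[of _ xs]) (auto simp: induced_edges_def)
    then show False using nc by simp
  qed
  ultimately show ?thesis by (simp add: tree_def)
qed

text \<open>The consecutive pairs of a cycle are distinct because its length is at least 3. The
  count makes a cycle accessible to the first moment estimate.\<close>

lemma cycle_many_edges:
  assumes "3 \<le> length xs" "distinct xs" "\<forall>i < length xs. {xs ! i, xs ! ((i + 1) mod length xs)} \<in> E"
  shows "length xs \<le> card (induced_edges E (set xs))"
proof -
  define l where "l = length xs"
  define s where "s i = {xs ! i, xs ! ((i + 1) mod l)}" for i
  have "inj_on s {..<l}"
  proof (rule inj_onI)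
    fix i j assume ij: "i \<in> {..<l}" "j \<in> {..<l}" "s i = s j"
    have m: "(i + 1) mod l < l" "(j + 1) mod l < l" using assms(1) by (auto simp: l_def intro!: mod_less_divisor)
    \<comment> \<open>Equal pairs with different starting points would be traversed in opposite
      directions. This makes \<open>j + 2\<close> congruent to \<open>j\<close> modulo
      \<open>l\<close>, which contradicts \<open>l >= 3\<close>.\<close>
    have "i = j \<or> (i = (j + 1) mod l \<and> (i + 1) mod l = j)"
      using ij m assms(2) unfolding s_def doubleton_eq_iff l_def
      by (auto simp: nth_eq_iff_index_eq)
    then show "i = j"
    proof
      assume a: "i = (j + 1) mod l \<and> (i + 1) mod l = j"
      show "i = j"
      proof (cases "j + 1 = l")
        case True
        then have "i = 0" using a by simp
        then have "1 mod l = j" using conjunct2[OF a] by (simp only: add_0)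
        moreover have "1 mod l = 1" using assms(1) by (intro mod_less) (simp add: l_def)
        ultimately have "j = 1" by simp
        then show ?thesis using True assms(1) by (simp add: l_def)
      next
        case False
        then have "i = j + 1" using a ij by auto
        then have "(j + 2) mod l = j" using conjunct2[OF a] by (simp only: add.assoc one_add_one)
        moreover have "j + 2 \<le> l" using False ij by auto
        ultimately show ?thesis using assms(1) by (cases "j + 2 = l") (auto simp: l_def)
      qed
    qed
  qed
  moreover have "s ` {..<l} \<subseteq> induced_edges E (set xs)"
    using assms unfolding s_def l_def induced_edges_def
    by (auto intro!: nth_mem mod_less_divisor)
  ultimately have "card {..<l} \<le> card (induced_edges E (set xs))"
    by (intro card_inj_on_le[of s]) (auto intro: finite_induced_edges)
  then show ?thesis by (simp add: l_def)
qed

text \<open>Labels decreasing from child to parent let a tree be given by an arithmetic formula, as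
  is done for the host of the greedy embedding.\<close>

lemma tree_of_parent:
  fixes n :: nat
  assumes "n > 0" and par: "\<And>x. 0 < x \<Longrightarrow> par x < x"
  shows "tree {0..<n} {{x, par x} |x. 0 < x \<and> x < n}" (is "tree ?V ?E")
proof -
  have "graph ?V ?E"
    unfolding graph_def
  proof (intro conjI ballI)
    fix e assume "e \<in> ?E"
    then obtain x where "e = {x, par x}" "0 < x" "x < n" by auto
    then show "\<exists>x y. x \<noteq> y \<and> x \<in> ?V \<and> y \<in> ?V \<and> e = {x, y}"
      using par[of x] by (intro exI[of _ x] exI[of _ "par x"]) auto
  qed simp
  moreover have r0: "reach ?E x 0" if "x < n" for x
    using that
  proof (induction x rule: less_induct)
    case (less x)
    show ?case
    proof (cases "x = 0")
      case True then show ?thesis by (simp add: reach_def)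
    next
      case False
      then have "{x, par x} \<in> ?E" using less by auto
      moreover have "reach ?E (par x) 0" using less par[of x] False by auto
      ultimately show ?thesis by (rule reach_trans[OF reach_edge])
    qed
  qed
  then have "connected_graph ?V ?E"
    unfolding connected_graph_def using assms(1)
    by (auto intro: reach_trans[OF r0 reach_sym[OF r0]])
  moreover have "\<not> has_cycle ?V ?E"
  proof
    assume "has_cycle ?V ?E"
    then obtain xs where xs: "3 \<le> length xs" "distinct xs"
      and e: "\<forall>i < length xs. {xs ! i, xs ! ((i + 1) mod length xs)} \<in> ?E"
      unfolding has_cycle_def by auto
    define l where "l = length xs"
    have l3: "3 \<le> l" using xs l_def by simp
    have "set xs \<noteq> {}" using xs by auto
    then have "Max (set xs) \<in> set xs" by simp
    then obtain i where i: "i < l" "xs ! i = Max (set xs)" by (auto simp: in_set_conv_nth l_def)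
    text \<open>Both cycle neighbours of the largest vertex are smaller, so both are its parent.\<close>
    have nb: "xs ! j = par (xs ! i)" if jj: "j < l" "j \<noteq> i" "{xs ! i, xs ! j} \<in> ?E" for j
    proof -
      have "xs ! j \<le> xs ! i" using jj i by (simp add: l_def)
      moreover obtain x where x: "{xs ! i, xs ! j} = {x, par x}" "0 < x" using jj(3) by blast
      ultimately show ?thesis using par[OF x(2)] by (auto simp: doubleton_eq_iff)
    qed
    define j where "j = (i + 1) mod l"
    \<comment> \<open>The cyclic predecessor of \<open>i\<close>; truncated subtraction makes
      \<open>i = 0\<close> a separate case.\<close>
    define k where "k = (if i = 0 then l - 1 else i - 1)"
    have kl: "k < l" and ks: "(k + 1) mod l = i" using i l3 by (auto simp: k_def)
    have jl: "j < l" using l3 by (simp add: j_def)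
    have "j \<noteq> i" "k \<noteq> i" "j \<noteq> k"
      using i l3 by (auto simp: j_def k_def mod_Suc split: if_splits)
    moreover have "{xs ! i, xs ! j} \<in> ?E" using e[rule_format, of i] i(1) unfolding j_def l_def .
    moreover have "{xs ! k, xs ! i} \<in> ?E" using e[rule_format, of k] kl ks by (simp add: l_def)
    then have "{xs ! i, xs ! k} \<in> ?E" by (simp only: insert_commute)
    ultimately have "xs ! j = xs ! k" using nb[of j] nb[of k] jl kl by metis
    then show False using \<open>j \<noteq> k\<close> jl kl xs by (simp add: nth_eq_iff_index_eq l_def)
  qed
  ultimately show ?thesis by (simp add: tree_def)
qed

section \<open>The game on a subgraph\<close>

lemma has_copy_mono:
  assumes "has_copy E VH EH M" "M \<subseteq> M'" "E \<subseteq> E'"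
  shows "has_copy E' VH EH M'"
proof -
  obtain f where "inj_on f VH" "f ` VH \<subseteq> M" "\<And>x y. {x, y} \<in> EH \<Longrightarrow> {f x, f y} \<in> E"
    using assms(1) unfolding has_copy_def by auto
  then show ?thesis unfolding has_copy_def using assms(2,3) by (intro exI[of _ f]) auto
qed

lemma has_copy_image:
  assumes "has_copy E VH EH M" "inj_on g M" "\<And>x y. x \<in> M \<Longrightarrow> y \<in> M \<Longrightarrow> {x, y} \<in> E \<Longrightarrow> {g x, g y} \<in> E'"
    and "graph VH EH"
  shows "has_copy E' VH EH (g ` M)"
proof -
  obtain f where f: "inj_on f VH" "f ` VH \<subseteq> M" "\<And>x y. {x, y} \<in> EH \<Longrightarrow> {f x, f y} \<in> E"
    using assms(1) unfolding has_copy_def by blast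
  have "inj_on (g \<circ> f) VH" using f assms(2) by (meson comp_inj_on inj_on_subset)
  moreover have "{(g \<circ> f) x, (g \<circ> f) y} \<in> E'" if "{x, y} \<in> EH" for x y
    using that f assms(3)[of "f x" "f y"] graph_edgeD[OF assms(4) that] by auto
  ultimately show ?thesis using f unfolding has_copy_def
    by (intro exI[of _ "g \<circ> f"]) auto
qed

text \<open>The winner is determined only when the board is full. A copy once owned is never lost,
  and \<open>b > 0\<close> makes every turn of Breaker shrink the board, so the induction on the
  number of free vertices goes through.\<close>

lemma maker_win_of_copy:
  assumes fin: "finite V" and b: "b > 0" and "has_copy E VH EH M"
  shows "maker_win V E VH EH b mt M B"
  using assms(3)
proof (induction "card (V - (M \<union> B))" arbitrary: mt M B rule: less_induct)
  case less
  show ?case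
  proof (cases "V - (M \<union> B) = {}")
    case True
    then show ?thesis using less.prems by (rule mw_end)
  next
    case ne: False
    have fin': "finite (V - (M \<union> B))" using fin by simp
    show ?thesis
    proof (cases mt)
      case True
      obtain v where v: "v \<in> V - (M \<union> B)" using ne by auto
      have "V - (insert v M \<union> B) \<subset> V - (M \<union> B)" using v by auto
      then have "card (V - (insert v M \<union> B)) < card (V - (M \<union> B))"
        using fin' psubset_card_mono by blast
      then have "maker_win V E VH EH b False (insert v M) B"
        using less.hyps has_copy_mono[OF less.prems] by blast
      then show ?thesis using v True by (auto intro: mw_maker)
    next
      case False
      have "maker_win V E VH EH b True M (B \<union> S)"
        if S: "S \<subseteq> V - (M \<union> B)" "card S = min b (card (V - (M \<union> B)))" for S
      proof -
        have "card S > 0" using S b ne fin' by (simp add: card_gt_0_iff)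
        then have "S \<noteq> {}" by auto
        then have "V - (M \<union> (B \<union> S)) \<subset> V - (M \<union> B)" using S by auto
        then have "card (V - (M \<union> (B \<union> S))) < card (V - (M \<union> B))"
          using fin' psubset_card_mono by blast
        then show ?thesis using less by blast
      qed
      then have "maker_win V E VH EH b False M B" by (intro mw_breaker[OF ne]) blast
      then show ?thesis using False by simp
    qed
  qed
qed

text \<open>Unlike in the actual game, Breaker may take fewer than \<open>b\<close> vertices in a turn, which makes
  restriction to a subgraph harmless.\<close>
fun forces :: "'a set \<Rightarrow> nat \<Rightarrow> ('a set \<Rightarrow> bool) \<Rightarrow> nat \<Rightarrow> 'a set \<Rightarrow> 'a set \<Rightarrow> bool" where
  "forces V b P 0 M B = P M"
| "forces V b P (Suc k) M B = (P M \<or> (\<exists>v\<in>V - (M \<union> B). \<forall>S. S \<subseteq> V - (insert v M \<union> B) \<and> card S \<le> b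
      \<longrightarrow> forces V b P k (insert v M) (B \<union> S)))"

section \<open>Composing strategies in the relaxed game\<close>

lemma forces_Suc: "forces V b P k M B \<Longrightarrow> forces V b P (Suc k) M B"
proof (induction k arbitrary: M B)
  case (Suc k)
  show ?case
  proof (cases "P M")
    case False
    then obtain v where "v \<in> V - (M \<union> B)"
      "\<And>S. S \<subseteq> V - (insert v M \<union> B) \<Longrightarrow> card S \<le> b \<Longrightarrow> forces V b P k (insert v M) (B \<union> S)"
      using Suc.prems by auto
    then show ?thesis unfolding forces.simps(2)[of V b P "Suc k"] using Suc.IH by metis
  qed simp
qed simp

lemma forces_le:
  assumes "forces V b P k M B" "k \<le> l"
  shows "forces V b P l M B"
  using assms(2,1)
proof (induction rule: dec_induct)
  case (step l)
  then show ?case using forces_Suc by metis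
qed

lemma forces_done: "P M \<Longrightarrow> forces V b P k M B"
  by (cases k) auto

text \<open>The bound on \<open>card B'\<close> is why rounds are counted: it lets the next stage
  find a free child or an untouched copy, whatever Breaker did before.\<close>

lemma forces_trans:
  assumes "forces V b P k M B" "B \<subseteq> V"
    and "\<And>M' B'. P M' \<Longrightarrow> B' \<subseteq> V \<Longrightarrow> card B' \<le> card B + b * k \<Longrightarrow> forces V b Q l M' B'"
  shows "forces V b Q (k + l) M B"
  using assms
proof (induction k arbitrary: M B)
  case (Suc k)
  show ?case
  proof (cases "P M")
    case True
    then have "forces V b Q l M B" using Suc by auto
    then show ?thesis by (rule forces_le) simp
  next
    case False
    then obtain v where v: "v \<in> V - (M \<union> B)"
      and vS: "\<And>S. S \<subseteq> V - (insert v M \<union> B) \<Longrightarrow> card S \<le> b \<Longrightarrow> forces V b P k (insert v M) (B \<union> S)"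
      using Suc.prems(1) by auto
    have "forces V b Q (k + l) (insert v M) (B \<union> S)"
      if S: "S \<subseteq> V - (insert v M \<union> B)" "card S \<le> b" for S
    proof (rule Suc.IH[OF vS[OF S]])
      show "B \<union> S \<subseteq> V" using Suc.prems(2) S by auto
      fix M' B' assume a: "P M'" "B' \<subseteq> V" "card B' \<le> card (B \<union> S) + b * k"
      have "card (B \<union> S) \<le> card B + b" using card_Un_le[of B S] S by linarith
      then have "card B' \<le> card B + b * Suc k" using a by simp
      then show "forces V b Q l M' B'" using Suc.prems(3) a by blast
    qed
    then show ?thesis using v by auto
  qed
qed simp

lemma forces_mono:
  assumes "forces V b P k M B" "B \<subseteq> V" "\<And>M'. P M' \<Longrightarrow> Q M'" "k \<le> l"
  shows "forces V b Q l M B"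
proof -
  have "forces V b Q (k + 0) M B"
    using assms(1,2) by (rule forces_trans) (auto intro: assms(3))
  then show ?thesis using assms(4) forces_le by auto
qed

text \<open>Every legal reply of Breaker has at most \<open>b\<close> vertices and so is among the
  replies allowed in \<open>forces\<close>; once the copy is complete, the rest of the play is
  arbitrary.\<close>

lemma forces_maker_win:
  assumes fin: "finite V" and b: "b > 0"
    and "forces V b (has_copy E VH EH) k M B"
  shows "maker_win V E VH EH b True M B"
  using assms(3)
proof (induction k arbitrary: M B)
  case 0
  then show ?case using maker_win_of_copy[OF fin b] by auto
next
  case (Suc k)
  show ?case
  proof (cases "has_copy E VH EH M")
    case True
    then show ?thesis by (rule maker_win_of_copy[OF fin b])
  next
    case False
    then obtain v where v: "v \<in> V - (M \<union> B)"
      and vS: "\<And>S. S \<subseteq> V - (insert v M \<union> B) \<Longrightarrow> card S \<le> b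
        \<Longrightarrow> forces V b (has_copy E VH EH) k (insert v M) (B \<union> S)"
      using Suc.prems(1) by auto
    show ?thesis
    proof (rule mw_maker[OF v])
      show "maker_win V E VH EH b False (insert v M) B"
      proof (cases "V - (insert v M \<union> B) = {}")
        case True
        \<comment> \<open>Maker's move has filled the board, so only \<open>mw_end\<close> applies
          at Breaker's turn; the empty reply shows that the copy is already complete.\<close>
        have "forces V b (has_copy E VH EH) k (insert v M) B" using vS[of "{}"] by simp
        then have "has_copy E VH EH (insert v M)" using True by (cases k) auto
        then show ?thesis using True by (intro mw_end)
      next
        case False
        then show ?thesis using Suc.IH[OF vS] by (intro mw_breaker) auto
      qed
    qed
  qed
qed

text \<open>Maker plays on the image of \<open>VT\<close> under \<open>g\<close> while simulating
  his winning game on \<open>VT\<close>. The simulated Breaker set \<open>Bt\<close> may be larger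
  than the real one, but covers all real Breaker vertices of the image. \<open>M0\<close> holds
  Maker's earlier vertices, and \<open>S\<close> is a reply of Breaker that has been made but not
  yet simulated; hence it is empty on Maker's turn. Each round uses a new vertex of
  \<open>VT\<close>, which gives the number of rounds.\<close>

lemma maker_win_forces_copy:
  assumes "maker_win VT ET VC EC b mt Mt Bt"
    and fin: "finite VT" and inj: "inj_on g VT" and gV: "g ` VT \<subseteq> V" and gC: "graph VC EC"
    and hom: "\<And>x y. {x, y} \<in> ET \<Longrightarrow> {g x, g y} \<in> E"
    and M0: "M0 \<inter> g ` VT = {}"
    and "Mt \<subseteq> VT" "B \<inter> g ` VT \<subseteq> g ` Bt" "Bt \<subseteq> VT"
    and "mt \<Longrightarrow> S = {}" "\<not> mt \<Longrightarrow> S \<subseteq> V - (M0 \<union> g ` Mt \<union> B) \<and> card S \<le> b" "finite V"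
  shows "forces V b (\<lambda>M. \<exists>Mt'\<subseteq>VT. M = M0 \<union> g ` Mt' \<and> has_copy E VC EC (g ` Mt'))
           (card (VT - Mt)) (M0 \<union> g ` Mt) (B \<union> S)"
  using assms(1,8-)
proof (induction arbitrary: B S rule: maker_win.induct)
  case (mw_end M Bt mt)
  have "inj_on g M" using inj mw_end.prems(1) by (rule inj_on_subset)
  with mw_end.hyps(2) have "has_copy E VC EC (g ` M)"
    by (rule has_copy_image) (auto intro: hom gC)
  then show ?case using mw_end.prems(1) by (intro forces_done) auto
next
  case (mw_maker v M Bt)
  have v: "v \<in> VT" "v \<notin> M" "v \<notin> Bt" using mw_maker.hyps(1) by auto
  have S: "S = {}" using mw_maker.prems(4) by simp
  have "g v \<notin> M0" using v M0 by auto
  moreover have nM: "g v \<notin> g ` M"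
    using v inj_on_image_mem_iff[OF inj v(1) mw_maker.prems(1)] by simp
  moreover have "g v \<notin> g ` Bt"
    using v inj_on_image_mem_iff[OF inj v(1) mw_maker.prems(3)] by simp
  then have "g v \<notin> B" using mw_maker.prems(2) v by auto
  moreover have "g v \<in> V" using gV v by auto
  ultimately have gv: "g v \<in> V - (M0 \<union> g ` M \<union> (B \<union> S))" using S by auto
  have c: "card (VT - M) = Suc (card (VT - insert v M))"
  proof -
    have "card (VT - M) = Suc (card (VT - M - {v}))" using fin v by (intro card.remove) auto
    then show ?thesis by (subst Diff_insert)
  qed
  have "forces V b (\<lambda>M. \<exists>Mt'\<subseteq>VT. M = M0 \<union> g ` Mt' \<and> has_copy E VC EC (g ` Mt'))
           (card (VT - insert v M)) (M0 \<union> g ` insert v M) (B \<union> S')"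
    if S': "S' \<subseteq> V - (insert (g v) (M0 \<union> g ` M) \<union> B)" "card S' \<le> b" for S'
    using S' mw_maker.prems(1-3,6) v by (intro mw_maker.IH) auto
  then show ?case unfolding c forces.simps
    by (intro disjI2 bexI[OF _ gv]) (auto simp: S)
next
  case (mw_breaker M Bt)
  \<comment> \<open>The part of the reply that the simulation has not yet attributed to Breaker. It
    may be smaller than a legal move on \<open>VT\<close>, so it is padded to a set
    \<open>St\<close> of exactly the required size.\<close>
  define R where "R = {x \<in> VT. g x \<in> S} - Bt"
  have S: "S \<subseteq> V - (M0 \<union> g ` M \<union> B)" "card S \<le> b" using mw_breaker.prems(5) by auto
  have finS: "finite S" using S mw_breaker.prems(6) by (auto intro: finite_subset)
  have R: "R \<subseteq> VT - (M \<union> Bt)" using S by (auto simp: R_def)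
  have "card R \<le> card S"
  proof (rule card_inj_on_le[of g])
    show "inj_on g R" using inj by (rule inj_on_subset) (auto simp: R_def)
  qed (auto simp: R_def finS)
  moreover have "card R \<le> card (VT - (M \<union> Bt))" using R fin by (intro card_mono) auto
  ultimately have "card R \<le> min b (card (VT - (M \<union> Bt)))" using S by auto
  then obtain St where St: "R \<subseteq> St" "St \<subseteq> VT - (M \<union> Bt)" "card St = min b (card (VT - (M \<union> Bt)))"
    using exists_subset_between[of R "min b (card (VT - (M \<union> Bt)))" "VT - (M \<union> Bt)"] R fin by auto
  have "(B \<union> S) \<inter> g ` VT \<subseteq> g ` (Bt \<union> St)"
    using mw_breaker.prems(2) St(1) by (auto simp: R_def)
  then have "forces V b (\<lambda>M. \<exists>Mt'\<subseteq>VT. M = M0 \<union> g ` Mt' \<and> has_copy E VC EC (g ` Mt'))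
           (card (VT - M)) (M0 \<union> g ` M) ((B \<union> S) \<union> {})"
    using mw_breaker.IH[rule_format, OF conjI[OF St(2,3)], THEN conjunct2, rule_format, of "B \<union> S" "{}"] St mw_breaker.prems(1,3,6) by auto
  then show ?case by simp
qed

text \<open>The components in \<open>D\<close> are treated one after another. Keeping Maker's
  vertices inside copies of the trees already treated makes every copy of the next tree free of
  them. Copies are disjoint, so each Breaker vertex spoils at most one; he owns at most
  \<open>b\<close> vertices from \<open>B0\<close> and \<open>b\<close> for each of at most
  \<open>v * card D\<close> rounds, which is fewer than \<open>N\<close>.\<close>

lemma forces_component_copies:
  fixes VT :: "'c \<Rightarrow> 't set" and VC :: "'c \<Rightarrow> 'b set"
  assumes fin: "finite V" and finD: "finite D"
    and inj: "inj_on \<phi> (Sigma (D \<times> {..<N}) (\<lambda>i. VT (fst i)))"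
    and img: "\<phi> ` Sigma (D \<times> {..<N}) (\<lambda>i. VT (fst i)) \<subseteq> V"
    and hom: "\<And>c j x y. c \<in> D \<Longrightarrow> j < N \<Longrightarrow> {x, y} \<in> ET c \<Longrightarrow> {\<phi> ((c, j), x), \<phi> ((c, j), y)} \<in> E"
    and win: "\<And>c. c \<in> D \<Longrightarrow> maker_win (VT c) (ET c) (VC c) (EC c) b True {} {}"
    and VT: "\<And>c. c \<in> D \<Longrightarrow> finite (VT c) \<and> card (VT c) \<le> v" and gC: "\<And>c. c \<in> D \<Longrightarrow> graph (VC c) (EC c)"
    and B0: "B0 \<subseteq> V" "card B0 \<le> b" and N: "b + b * (v * card D) < N"
  shows "forces V b (\<lambda>M. M \<subseteq> \<phi> ` Sigma (D \<times> {..<N}) (\<lambda>i. VT (fst i)) \<and>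
           (\<forall>c\<in>D. \<exists>j<N. has_copy E (VC c) (EC c) (M \<inter> \<phi> ` ({(c, j)} \<times> VT c)))) (v * card D) {} B0"
  using finD inj img hom win VT gC N
proof (induction D rule: finite_induct)
  case empty
  then show ?case by auto
next
  case (insert c D)
  let ?U = "\<lambda>D. Sigma (D \<times> {..<N}) (\<lambda>i. VT (fst i))"
  let ?Q = "\<lambda>D M. M \<subseteq> \<phi> ` ?U D \<and>
           (\<forall>c\<in>D. \<exists>j<N. has_copy E (VC c) (EC c) (M \<inter> \<phi> ` ({(c, j)} \<times> VT c)))"
  have sub: "?U D \<subseteq> ?U (insert c D)" by auto
  have IH: "forces V b (?Q D) (v * card D) {} B0"
  proof (rule insert.IH)
    show "inj_on \<phi> (?U D)" using insert.prems(1) sub by (rule inj_on_subset)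
    show "\<phi> ` ?U D \<subseteq> V" using insert.prems(2) sub by blast
    have "b * (v * card D) \<le> b * (v * card (insert c D))"
      using insert by (intro mult_le_mono) auto
    then show "b + b * (v * card D) < N" using insert.prems(7) by linarith
  qed (use insert.prems in auto)
  have "forces V b (?Q (insert c D)) (v * card D + v) {} B0"
    using IH B0(1)
  proof (rule forces_trans)
    fix M' B' assume M': "?Q D M'" and B': "B' \<subseteq> V" "card B' \<le> card B0 + b * (v * card D)"
    have finB': "finite B'" using B' fin finite_subset by auto
    have lt: "card B' < N"
    proof -
      have "b * (v * card D) \<le> b * (v * card (insert c D))"
        using insert by (intro mult_le_mono) auto
      then show ?thesis using insert.prems(7) B' B0 by linarith
    qed
    have "\<exists>j<N. B' \<inter> \<phi> ` ({(c, j)} \<times> VT c) = {}"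
    proof (rule ccontr)
      assume "\<not> ?thesis"
      then have "\<forall>j\<in>{..<N}. \<exists>x. x \<in> VT c \<and> \<phi> ((c, j), x) \<in> B'" by fastforce
      then obtain h where h: "\<And>j. j < N \<Longrightarrow> h j \<in> VT c \<and> \<phi> ((c, j), h j) \<in> B'"
        unfolding bchoice_iff by auto
      have "inj_on (\<lambda>j. \<phi> ((c, j), h j)) {..<N}"
      proof (rule inj_onI)
        fix i j assume ij: "i \<in> {..<N}" "j \<in> {..<N}" "\<phi> ((c, i), h i) = \<phi> ((c, j), h j)"
        have "((c, i), h i) = ((c, j), h j)"
          using insert.prems(1) ij(3) by (rule inj_onD) (use ij h in auto)
        then show "i = j" by simp
      qed
      then have "card {..<N} \<le> card B'"
        using h finB' by (intro card_inj_on_le[of "\<lambda>j. \<phi> ((c, j), h j)"]) auto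
      then show False using lt by simp
    qed
    then obtain j where j: "j < N" "B' \<inter> \<phi> ` ({(c, j)} \<times> VT c) = {}" by auto
    let ?g = "\<lambda>x. \<phi> ((c, j), x)"
    have g_img: "?g ` VT c = \<phi> ` ({(c, j)} \<times> VT c)" by auto
    have injg: "inj_on ?g (VT c)"
      using j by (intro inj_onI) (auto dest: inj_onD[OF insert.prems(1)])
    have disj: "\<phi> ` ?U D \<inter> ?g ` VT c = {}"
    proof -
      have "?U D \<inter> {(c, j)} \<times> VT c = {}" using insert.hyps by auto
      then have "\<phi> ` ?U D \<inter> \<phi> ` ({(c, j)} \<times> VT c) = {}"
        using j by (subst inj_on_image_Int[OF insert.prems(1), symmetric]) auto
      then show ?thesis by (simp add: g_img)
    qed
    have "forces V b (\<lambda>M. \<exists>Mt'\<subseteq>VT c. M = M' \<union> ?g ` Mt' \<and> has_copy E (VC c) (EC c) (?g ` Mt'))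
        (card (VT c - {})) (M' \<union> ?g ` {}) (B' \<union> {})"
    proof (rule maker_win_forces_copy[OF insert.prems(4)[OF insertI1]])
      show "?g ` VT c \<subseteq> V" using insert.prems(2) j by auto
      show "M' \<inter> ?g ` VT c = {}" using M' disj by auto
      show "B' \<inter> ?g ` VT c \<subseteq> ?g ` {}" using j g_img by auto
    qed (use insert.prems injg j fin in auto)
    then have "forces V b (\<lambda>M. \<exists>Mt'\<subseteq>VT c. M = M' \<union> ?g ` Mt' \<and> has_copy E (VC c) (EC c) (?g ` Mt'))
        (card (VT c)) M' B'" by simp
    then show "forces V b (?Q (insert c D)) v M' B'"
      using B'(1)
    proof (rule forces_mono)
      show "card (VT c) \<le> v" using insert.prems by auto
      fix M assume "\<exists>Mt'\<subseteq>VT c. M = M' \<union> ?g ` Mt' \<and> has_copy E (VC c) (EC c) (?g ` Mt')"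
      then obtain Mt' where Mt': "Mt' \<subseteq> VT c" "M = M' \<union> ?g ` Mt'" "has_copy E (VC c) (EC c) (?g ` Mt')"
        by auto
      have "?g ` Mt' \<subseteq> \<phi> ` ?U (insert c D)" using Mt'(1) j by auto
      moreover have "M' \<subseteq> \<phi> ` ?U (insert c D)" using M' sub by blast
      ultimately have "M \<subseteq> \<phi> ` ?U (insert c D)" using Mt'(2) by simp
      moreover have "has_copy E (VC c) (EC c) (M \<inter> \<phi> ` ({(c, j)} \<times> VT c))"
        using Mt'(3) by (rule has_copy_mono) (use Mt' in auto)
      moreover have "\<exists>j<N. has_copy E (VC d) (EC d) (M \<inter> \<phi> ` ({(d, j)} \<times> VT d))" if d: "d \<in> D" for d
      proof -
        obtain j where "j < N" "has_copy E (VC d) (EC d) (M' \<inter> \<phi> ` ({(d, j)} \<times> VT d))"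
          using M' d by blast
        moreover have "M' \<inter> \<phi> ` ({(d, j)} \<times> VT d) \<subseteq> M \<inter> \<phi> ` ({(d, j)} \<times> VT d)"
          using Mt'(2) by auto
        ultimately show ?thesis using has_copy_mono[OF _ _ subset_refl] by blast
      qed
      ultimately show "?Q (insert c D) M" using j by blast
    qed
  qed
  then show ?case using insert.hyps by (simp add: add.commute)
qed

section \<open>Component-wise play\<close>

lemma component_self: "x \<in> V \<Longrightarrow> x \<in> {y \<in> V. reach E x y}"
  by (simp add: reach_def)

text \<open>Each vertex is mapped by the embedding of its own component. Disjointness of the sets
  \<open>A C\<close> makes the glued map injective, and no edge joins two components.\<close>

lemma has_copy_of_components:
  assumes g: "graph VH EH"
    and copy: "\<And>C. C \<in> components VH EH \<Longrightarrow> has_copy E C (induced_edges EH C) (A C)"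
    and sub: "\<And>C. C \<in> components VH EH \<Longrightarrow> A C \<subseteq> M"
    and disj: "\<And>C D. C \<in> components VH EH \<Longrightarrow> D \<in> components VH EH \<Longrightarrow> C \<noteq> D \<Longrightarrow> A C \<inter> A D = {}"
  shows "has_copy E VH EH M"
proof -
  define comp where "comp x = {y \<in> VH. reach EH x y}" for x
  have comp: "comp x \<in> components VH EH" "x \<in> comp x" if "x \<in> VH" for x
    using that component_self[OF that, of EH] by (auto simp: components_def comp_def)
  have "\<forall>C\<in>components VH EH. \<exists>f. inj_on f C \<and> f ` C \<subseteq> A C \<and>
      (\<forall>x y. {x, y} \<in> induced_edges EH C \<longrightarrow> {f x, f y} \<in> E)"
    using copy unfolding has_copy_def by blast
  from bchoice[OF this] obtain F where "\<forall>C\<in>components VH EH. inj_on (F C) C \<and> F C ` C \<subseteq> A C \<and>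
      (\<forall>x y. {x, y} \<in> induced_edges EH C \<longrightarrow> {F C x, F C y} \<in> E)" ..
  note F = bspec[OF this]
  define f where "f x = F (comp x) x" for x
  have fA: "f x \<in> A (comp x)" if "x \<in> VH" for x
    using F[OF comp(1)[OF that]] comp(2)[OF that] by (auto simp: f_def)
  have "inj_on f VH"
  proof (rule inj_onI)
    fix x y assume xy: "x \<in> VH" "y \<in> VH" "f x = f y"
    have eq: "comp x = comp y"
      using disj[OF comp(1)[OF xy(1)] comp(1)[OF xy(2)]] fA[OF xy(1)] fA[OF xy(2)] xy(3) by auto
    then have "x \<in> comp y" "y \<in> comp y" "F (comp y) x = F (comp y) y"
      using comp(2) xy by (auto simp: f_def)
    then show "x = y" using F[OF comp(1)[OF xy(2)]] by (auto dest: inj_onD)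
  qed
  moreover have "f ` VH \<subseteq> M" using fA sub comp(1) by blast
  moreover have "{f x, f y} \<in> E" if e: "{x, y} \<in> EH" for x y
  proof -
    have V: "x \<in> VH" "y \<in> VH" using graph_edgeD[OF g e] by auto
    have r: "reach EH x y" using e by (rule reach_edge)
    have "comp x = comp y"
      unfolding comp_def using reach_trans[OF r] reach_trans[OF reach_sym[OF r]] by blast
    moreover have "{x, y} \<in> induced_edges EH (comp x)"
      using e V r comp(2)[OF V(1)] by (auto simp: induced_edges_def comp_def)
    ultimately show ?thesis using F[OF comp(1)[OF V(1)]] by (auto simp: f_def)
  qed
  ultimately show ?thesis unfolding has_copy_def by blast
qed

text \<open>A connected graph is mapped into a single component of the host. To prevent the forest
  it therefore suffices for Breaker to prevent \<open>C\<close> in each component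
  separately.\<close>

lemma has_copy_in_component:
  assumes g: "graph V E" and gH: "graph VH EH" and C: "C \<in> components VH EH"
    and copy: "has_copy E VH EH M" and M: "M \<subseteq> V"
  shows "\<exists>K\<in>components V E. has_copy (induced_edges E K) C (induced_edges EH C) (M \<inter> K)"
proof -
  obtain x where x: "x \<in> VH" "C = {y \<in> VH. reach EH x y}" using C by (auto simp: components_def)
  obtain f where f: "inj_on f VH" "f ` VH \<subseteq> M" "\<And>x y. {x, y} \<in> EH \<Longrightarrow> {f x, f y} \<in> E"
    using copy unfolding has_copy_def by blast
  have fr: "reach E (f x) (f y)" if "reach EH x y" for y
    using that unfolding reach_def
  proof (induction rule: rtranclp_induct)
    case (step y z)
    then show ?case using f(3) by (meson rtranclp.rtrancl_into_rtrancl)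
  qed simp
  define K where "K = {y \<in> V. reach E (f x) y}"
  have "f x \<in> V" using x f M by auto
  then have "K \<in> components V E" by (auto simp: components_def K_def)
  moreover have fK: "f ` C \<subseteq> M \<inter> K" using f(2) M fr x by (auto simp: K_def)
  moreover have "inj_on f C" using f(1) x by (auto intro: inj_on_subset)
  moreover have "{f y, f z} \<in> induced_edges E K" if "{y, z} \<in> induced_edges EH C" for y z
    using that f(3)[of y z] fK by (auto simp: induced_edges_def)
  ultimately show ?thesis unfolding has_copy_def by blast
qed

text \<open>If Maker's move fills the board, \<open>mw_breaker\<close> does not apply and the reply
  is empty: on a full board the outcome does not depend on whose turn it is.\<close>

lemma not_maker_win_breaker_reply:
  assumes "\<not> maker_win V E VH EH b True M B" "v \<in> V - (M \<union> B)"
  shows "\<exists>S\<subseteq>V - (insert v M \<union> B). card S \<le> b \<and> \<not> maker_win V E VH EH b True (insert v M) (B \<union> S)"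
proof -
  have nF: "\<not> maker_win V E VH EH b False (insert v M) B"
    using assms mw_maker by metis
  show ?thesis
  proof (cases "V - (insert v M \<union> B) = {}")
    case True
    have "\<not> maker_win V E VH EH b True (insert v M) B"
    proof
      assume "maker_win V E VH EH b True (insert v M) B"
      then have "has_copy E VH EH (insert v M)" using True by cases auto
      then show False using nF mw_end[OF True] by metis
    qed
    then show ?thesis by (intro exI[of _ "{}"]) auto
  next
    case False
    then show ?thesis using nF mw_breaker[OF False, of b E VH EH] by (metis min.cobounded1)
  qed
qed

context
  fixes V :: "'a set" and E VH and EH :: "'b set set" and b :: nat and C
  assumes g: "graph V E" and gH: "graph VH EH" and b: "b > 0" and C: "C \<in> components VH EH"
begin

text \<open>Maker's loss in \<open>K\<close> is required from some subset \<open>Bk\<close> of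
  Breaker's vertices rather than from \<open>B \<inter> K\<close>. Vertices that Breaker claims only
  to complete his move then leave the invariant intact, since enlarging \<open>B\<close> keeps
  \<open>Bk\<close> a subset.\<close>

lemma breaker_win_componentwise_aux:
  assumes "M \<subseteq> V"
    and "\<And>K. K \<in> components V E \<Longrightarrow>
      \<exists>Bk\<subseteq>B. \<not> maker_win K (induced_edges E K) C (induced_edges EH C) b True (M \<inter> K) Bk"
  shows "breaker_win V E VH EH b True M B"
  using assms
proof (induction "card (V - (M \<union> B))" arbitrary: M B rule: less_induct)
  case less
  let ?win = "\<lambda>K. maker_win K (induced_edges E K) C (induced_edges EH C) b"
  have finV: "finite V" using g by (simp add: graph_def)
  have finK: "finite K" "K \<subseteq> V" if "K \<in> components V E" for K
    using that finV by (auto simp: components_def)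
  \<comment> \<open>A copy of the forest would give Maker a copy of \<open>C\<close> in one
    component, and with it he wins there whatever Breaker owns.\<close>
  have nocopy: "\<not> has_copy E VH EH M'"
    if M': "M' \<subseteq> V" and nw: "\<And>K. K \<in> components V E \<Longrightarrow> \<exists>Bk. \<not> ?win K True (M' \<inter> K) Bk" for M'
  proof
    assume "has_copy E VH EH M'"
    then obtain K where K: "K \<in> components V E" "has_copy (induced_edges E K) C (induced_edges EH C) (M' \<inter> K)"
      using has_copy_in_component[OF g gH C _ M'] by blast
    then show False using maker_win_of_copy[OF finK(1)[OF K(1)] b K(2)] nw[OF K(1)] by blast
  qed
  show ?case
  proof (cases "V - (M \<union> B) = {}")
    case True
    have "\<not> has_copy E VH EH M" using less.prems by (intro nocopy) blast+
    then show ?thesis using True by (intro bw_end)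
  next
    case False
    have "breaker_win V E VH EH b False (insert v M) B" if v: "v \<in> V - (M \<union> B)" for v
    proof -
      define K0 where "K0 = {y \<in> V. reach E v y}"
      have K0: "K0 \<in> components V E" "v \<in> K0"
        using v component_self[of v V E] by (auto simp: K0_def components_def)
      obtain B0 where B0: "B0 \<subseteq> B" "\<not> ?win K0 True (M \<inter> K0) B0" using less.prems(2)[OF K0(1)] by auto
      have "v \<in> K0 - (M \<inter> K0 \<union> B0)" using v K0 B0 by auto
      then obtain S where S: "S \<subseteq> K0 - (insert v (M \<inter> K0) \<union> B0)" "card S \<le> b"
        "\<not> ?win K0 True (insert v (M \<inter> K0)) (B0 \<union> S)"
        using not_maker_win_breaker_reply[OF B0(2)] by blast
      have insK0: "insert v M \<inter> K0 = insert v (M \<inter> K0)" using K0 by auto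
      \<comment> \<open>\<open>S\<close> was chosen against \<open>B0\<close> and may contain
        vertices that Breaker already owns, so only \<open>S - B\<close> remains to be claimed; any
        larger set \<open>R\<close> serves as the actual move.\<close>
      have inv: "\<exists>Bk\<subseteq>B \<union> R. \<not> ?win K True (insert v M \<inter> K) Bk"
        if K: "K \<in> components V E" and R: "S - B \<subseteq> R" for K R
      proof (cases "v \<in> K")
        case True
        obtain x where x: "x \<in> V" "K = {y \<in> V. reach E x y}" using K by (auto simp: components_def)
        then have r: "reach E x v" using True by simp
        have "K = K0" unfolding x(2) K0_def using reach_trans[OF r] reach_trans[OF reach_sym[OF r]] by blast
        then show ?thesis using S(3) B0(1) R insK0 by (intro exI[of _ "B0 \<union> S"]) auto
      next
        case False
        then have "insert v M \<inter> K = M \<inter> K" by auto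
        then show ?thesis using less.prems(2)[OF K] by auto
      qed
      let ?F = "V - (insert v M \<union> B)"
      have insV: "insert v M \<subseteq> V" using less.prems(1) v by auto
      have finF: "finite ?F" using finV by simp
      have SF: "S - B \<subseteq> ?F" using S(1) finK(2)[OF K0(1)] by auto
      show ?thesis
      proof (cases "?F = {}")
        case True
        have "\<not> has_copy E VH EH (insert v M)" using insV inv[of _ S] by (intro nocopy) blast+
        then show ?thesis using True by (intro bw_end)
      next
        case False
        have "finite S" using S(1) finK(1)[OF K0(1)] by (auto intro: finite_subset)
        then have "card (S - B) \<le> b" using S(2) card_mono[of S "S - B"] by fastforce
        moreover have "card (S - B) \<le> card ?F" using SF finF by (intro card_mono)
        ultimately obtain R where R: "S - B \<subseteq> R" "R \<subseteq> ?F" "card R = min b (card ?F)"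
          using exists_subset_between[of "S - B" "min b (card ?F)" ?F] SF finF by auto
        have "V - (insert v M \<union> (B \<union> R)) \<subset> V - (M \<union> B)" using v by auto
        then have "card (V - (insert v M \<union> (B \<union> R))) < card (V - (M \<union> B))"
          using finV by (intro psubset_card_mono) auto
        then have "breaker_win V E VH EH b True (insert v M) (B \<union> R)"
          using inv[OF _ R(1)] insV by (intro less.hyps) blast+
        then show ?thesis using False R by (intro bw_breaker[of _ _ _ R])
      qed
    qed
    then show ?thesis using False by (intro bw_maker) auto
  qed
qed

lemma breaker_win_componentwise:
  assumes nw: "\<And>K. K \<in> components V E \<Longrightarrow>
      \<not> maker_win K (induced_edges E K) C (induced_edges EH C) b True {} {}"
  shows "breaker_win V E VH EH b mf {} {}"
proof -
  \<comment> \<open>The witness is \<open>{}\<close> in every component, so \<open>B\<close> is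
    arbitrary and can be any opening move of Breaker.\<close>
  have T: "breaker_win V E VH EH b True {} B" for B
    using nw by (intro breaker_win_componentwise_aux) auto
  have finV: "finite V" using g by (simp add: graph_def)
  show ?thesis
  proof (cases "mf \<or> V = {}")
    case True
    show ?thesis
    proof (cases mf)
      case True
      then show ?thesis using T by simp
    next
      case False
      then have V: "V = {}" using True by simp
      have "\<not> has_copy E VH EH {}" using T[of "{}"] V by cases auto
      then show ?thesis using V by (intro bw_end) auto
    qed
  next
    case False
    obtain S where "S \<subseteq> V" "card S = min b (card V)"
      using obtain_subset_with_card_n[of "min b (card V)" V] by auto
    then have "breaker_win V E VH EH b False {} {}"
      using False T[of "{} \<union> S"] by (intro bw_breaker[of _ "{}" "{}" S]) auto
    then show ?thesis using False by simp
  qed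
qed

end

text \<open>The host is a heap: the children of \<open>y\<close> are the labels
  \<open>D * y + 1\<close> to \<open>D * y + D\<close>, cut off at \<open>n\<close>. Maker extends a
  connected part of the target by one vertex per turn, mapping it to a free child of the image of
  its neighbour.\<close>

lemma maker_wins_on_large_tree:
  fixes VH :: "'b set"
  assumes H: "tree VH EH" and b: "b > 0"
  shows "\<exists>(VT :: nat set) ET. tree VT ET \<and> maker_wins_game VT ET VH EH b True"
proof -
  have g: "graph VH EH" "\<not> has_cycle VH EH" and con: "connected_graph VH EH"
    using H by (auto simp: tree_def)
  have finH: "finite VH" using g by (simp add: graph_def)
  obtain r where r: "r \<in> VH" using con by (auto simp: connected_graph_def)
  define m where "m = card VH"
  \<comment> \<open>During \<open>m\<close> turns Maker claims at most \<open>m\<close> and Breaker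
    at most \<open>b * m\<close> vertices, so one of \<open>D\<close> children is always
    free.\<close>
  define D where "D = Suc ((b + 1) * m)"
  \<comment> \<open>A child of a label below \<open>(D + 1) ^ i\<close> lies below
    \<open>(D + 1) ^ (i + 1)\<close>, so the cut-off is not reached within \<open>m\<close>
    turns.\<close>
  define n where "n = (D + 1) ^ m"
  define par where "par x = (x - 1) div D" for x :: nat
  define E where "E = {{x, par x} |x. 0 < x \<and> x < n}"
  have D0: "D > 0" by (simp add: D_def)
  have m0: "m > 0" using r finH by (auto simp: m_def card_gt_0_iff)
  have tr: "tree {0..<n} E"
    unfolding E_def
  proof (rule tree_of_parent)
    show "par x < x" if "0 < x" for x
    proof -
      have "(x - 1) div D \<le> x - 1" by simp
      also have "\<dots> < x" using that by simp
      finally show ?thesis by (simp only: par_def)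
    qed
  qed (simp add: n_def)
  \<comment> \<open>The edge count stands for connectedness of \<open>W\<close>, in the form that
    contradicts \<open>acyclic_card_edges\<close> when a new vertex has two neighbours in
    \<open>W\<close>. All of Maker's vertices are image points, so their number is known.\<close>
  define Q where "Q i M \<longleftrightarrow> (\<exists>W f. W \<subseteq> VH \<and> card W = i \<and> i \<le> Suc (card (induced_edges EH W)) \<and>
    inj_on f W \<and> M = f ` W \<and> (\<forall>w\<in>W. f w < (D + 1) ^ i) \<and>
    (\<forall>x y. {x, y} \<in> induced_edges EH W \<longrightarrow> {f x, f y} \<in> E))" for i M
  have step: "forces {0..<n} b (Q (Suc i)) 1 M B"
    if i: "0 < i" "i < m" and Q: "Q i M" and B: "B \<subseteq> {0..<n}" "card B \<le> b * i" for i M B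
  proof -
    obtain W f where W: "W \<subseteq> VH" "card W = i" "i \<le> Suc (card (induced_edges EH W))"
      and f: "inj_on f W" "M = f ` W" "\<And>w. w \<in> W \<Longrightarrow> f w < (D + 1) ^ i"
        "\<And>x y. {x, y} \<in> induced_edges EH W \<Longrightarrow> {f x, f y} \<in> E"
      using Q unfolding Q_def by blast
    have finW: "finite W" using W(1) finH by (rule finite_subset)
    have "W \<noteq> {}" "W \<noteq> VH" using W(2) i by (auto simp: m_def)
    then obtain p q where pq: "p \<in> W" "q \<in> VH" "q \<notin> W" using W(1) by blast
    moreover have "reach EH p q" using con pq W(1) by (auto simp: connected_graph_def)
    ultimately obtain u w where uw: "{u, w} \<in> EH" "u \<in> W" "w \<notin> W"
      using reach_crossing_edge[of EH p q W] by blast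
    have wV: "w \<in> VH" using graph_edgeD[OF g(1) uw(1)] by auto
    have finI: "finite (induced_edges EH W)" using finite_induced_edges[OF finW] .
    have finI': "finite (induced_edges EH (insert w W))" using finite_induced_edges[of "insert w W"] finW by simp
    have nI: "{x, w} \<notin> induced_edges EH W" for x using uw(3) by (auto simp: induced_edges_def)
    text \<open>A second edge from the new vertex into the connected set would close a cycle.\<close>
    have uniq: "x = u" if x: "{x, w} \<in> EH" "x \<in> W" for x
    proof (rule ccontr)
      assume "x \<noteq> u"
      then have ne: "{x, w} \<noteq> {u, w}" using uw(3) x(2) by (auto simp: doubleton_eq_iff)
      have "insert {x, w} (insert {u, w} (induced_edges EH W)) \<subseteq> induced_edges EH (insert w W)"
        using uw x by (auto simp: induced_edges_def)
      then have "card (insert {x, w} (insert {u, w} (induced_edges EH W))) \<le> card (induced_edges EH (insert w W))"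
        using finI' by (intro card_mono)
      then have "Suc (Suc (card (induced_edges EH W))) \<le> card (induced_edges EH (insert w W))"
        using ne nI finI by simp
      moreover have "card (induced_edges EH (insert w W)) < card (insert w W)"
        using W(1) wV by (intro acyclic_card_edges[OF g]) auto
      ultimately show False using W finW uw(3) by simp
    qed
    have "card ((\<lambda>k. D * f u + Suc k) ` {..<D}) = D" by (simp add: card_image inj_on_def)
    moreover have "card (M \<union> B) < D"
    proof -
      have "card M \<le> i" using f(2) W(2) card_image_le[OF finW] by auto
      then have "card (M \<union> B) \<le> i + b * i" using card_Un_le[of M B] B(2) by linarith
      also have "\<dots> = (b + 1) * i" by simp
      also have "\<dots> \<le> (b + 1) * m" using i by (intro mult_le_mono2) simp
      finally show ?thesis by (simp add: D_def)
    qed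
    moreover have "finite (M \<union> B)" using f(2) finW B(1) by (auto intro: finite_subset)
    ultimately have "\<not> (\<lambda>k. D * f u + Suc k) ` {..<D} \<subseteq> M \<union> B"
      using card_mono by (metis linorder_not_less)
    then obtain k where k: "k < D" "D * f u + Suc k \<notin> M \<union> B" by auto
    define z where "z = D * f u + Suc k"
    have pz: "par z = f u" using k(1) by (simp add: par_def z_def)
    have "f u + 1 \<le> (D + 1) ^ i" using f(3)[OF uw(2)] by simp
    then have "D * (f u + 1) \<le> D * (D + 1) ^ i" by (rule mult_le_mono2)
    moreover have "z \<le> D * (f u + 1)" using k(1) by (simp add: z_def)
    moreover have "D * (D + 1) ^ i < (D + 1) ^ Suc i" by simp
    ultimately have z1: "z < (D + 1) ^ Suc i" by linarith
    also have "\<dots> \<le> n" unfolding n_def using i by (intro power_increasing) auto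
    finally have zn: "z < n" .
    have zE: "{f u, z} \<in> E"
    proof -
      have "{z, par z} \<in> E" using zn by (auto simp: E_def z_def)
      then show ?thesis using pz by (simp add: insert_commute)
    qed
    have "Q (Suc i) (insert z M)"
      unfolding Q_def
    proof (intro exI[of _ "insert w W"] exI[of _ "f(w := z)"] conjI allI impI ballI)
      show "insert w W \<subseteq> VH" using W wV by auto
      show "card (insert w W) = Suc i" using W finW uw by simp
      have "insert {u, w} (induced_edges EH W) \<subseteq> induced_edges EH (insert w W)"
        using uw by (auto simp: induced_edges_def)
      then have "card (insert {u, w} (induced_edges EH W)) \<le> card (induced_edges EH (insert w W))"
        using finI' by (intro card_mono)
      then show "Suc i \<le> Suc (card (induced_edges EH (insert w W)))" using W nI finI by simp
      have "z \<notin> f ` W" using k f(2) by (simp add: z_def)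
      then show "inj_on (f(w := z)) (insert w W)"
        using f(1) uw(3) by (auto simp: inj_on_def)
      show "insert z M = (f(w := z)) ` insert w W" using f(2) uw(3) by auto
      show "(f(w := z)) x < (D + 1) ^ Suc i" if "x \<in> insert w W" for x
      proof (cases "x = w")
        case True then show ?thesis using z1 by simp
      next
        case False
        then have "f x < (D + 1) ^ i" using that f(3) by auto
        also have "\<dots> \<le> (D + 1) ^ Suc i" by simp
        finally show ?thesis using False by simp
      qed
      fix x y assume xy: "{x, y} \<in> induced_edges EH (insert w W)"
      have xyE: "{x, y} \<in> EH" and xyW: "x \<in> insert w W" "y \<in> insert w W"
        using xy by (auto simp: induced_edges_def)
      have nxy: "x \<noteq> y" using graph_edgeD[OF g(1) xyE] by auto
      show "{(f(w := z)) x, (f(w := z)) y} \<in> E"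
      proof (cases "x = w")
        case True
        then have "y = u" using uniq[of y] xyE xyW nxy by (auto simp: insert_commute)
        then show ?thesis using True nxy zE by (simp add: insert_commute)
      next
        case x: False
        show ?thesis
        proof (cases "y = w")
          case True
          then have "x = u" using uniq[of x] xyE xyW nxy by auto
          then show ?thesis using True nxy zE by simp
        next
          case False
          then have "{x, y} \<in> induced_edges EH W" using x xy by (auto simp: induced_edges_def)
          then show ?thesis using f(4) x False by simp
        qed
      qed
    qed
    moreover have "z \<in> {0..<n} - (M \<union> B)" using zn k by (simp add: z_def)
    ultimately show ?thesis by auto
  qed
  \<comment> \<open>The opening move puts a vertex \<open>r\<close> of the target at the root 0;
    from then on each turn is one application of \<open>step\<close>.\<close>
  have "forces {0..<n} b (Q (Suc i)) (Suc i) {} {}" if "i < m" for i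
    using that
  proof (induction i)
    case 0
    have "Q (Suc 0) {0}"
      unfolding Q_def using r graph_edgeD(3)[OF g(1), of r r]
      by (intro exI[of _ "{r}"] exI[of _ "\<lambda>_. 0"]) (auto simp: induced_edges_def)
    moreover have "0 < n" by (simp add: n_def)
    ultimately show ?case by auto
  next
    case (Suc i)
    then have "forces {0..<n} b (Q (Suc i)) (Suc i) {} {}" by simp
    then have "forces {0..<n} b (Q (Suc (Suc i))) (Suc i + 1) {} {}"
      by (rule forces_trans) (use step[of "Suc i"] Suc.prems in auto)
    then show ?case by simp
  qed
  from this[of "m - 1"] have "forces {0..<n} b (Q m) m {} {}" using m0 by simp
  then have "forces {0..<n} b (has_copy E VH EH) m {} {}"
  proof (rule forces_mono)
    fix M assume "Q m M"
    then obtain W f where W: "W \<subseteq> VH" "card W = m"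
      and f: "inj_on f W" "M = f ` W" "\<And>x y. {x, y} \<in> induced_edges EH W \<Longrightarrow> {f x, f y} \<in> E"
      unfolding Q_def by blast
    have "W = VH" using W finH by (simp add: m_def card_subset_eq)
    then show "has_copy E VH EH M"
      using f induced_edges_self[OF g(1)] unfolding has_copy_def by auto
  qed auto
  then have "maker_win {0..<n} E VH EH b True {} {}" by (intro forces_maker_win b) auto
  then show ?thesis using tr unfolding maker_wins_game_def by blast
qed

section \<open>Subgraphs of the binomial random graph\<close>

lemma finite_all_edges: "finite (all_edges n)"
  by (rule finite_subset[of _ "Pow {0..<n}"]) (auto simp: all_edges_def)

lemma doubleton_all_edges:
  assumes "i \<noteq> j" "i < n" "j < n"
  shows "{i, j} \<in> all_edges n"
proof (cases "i < j")
  case True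
  then show ?thesis using assms unfolding all_edges_def by blast
next
  case False
  then have "j < i" "{i, j} = {j, i}" using assms by auto
  then show ?thesis using assms unfolding all_edges_def by blast
qed

lemma graph_all_edges: "E \<subseteq> all_edges n \<Longrightarrow> graph {0..<n} E"
  unfolding graph_def
proof (intro conjI ballI)
  fix e assume "E \<subseteq> all_edges n" "e \<in> E"
  then obtain i j where "i < j" "j < n" "e = {i, j}" unfolding all_edges_def by blast
  then show "\<exists>x y. x \<noteq> y \<and> x \<in> {0..<n} \<and> y \<in> {0..<n} \<and> e = {x, y}"
    by (intro exI[of _ i] exI[of _ j]) auto
qed simp

lemma set_pmf_gnp: "E \<in> set_pmf (gnp n p) \<Longrightarrow> E \<subseteq> all_edges n"
  by (auto simp: gnp_def)

lemma prob_gnp_superset: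
  assumes p: "0 \<le> p" "p \<le> 1" and F: "F \<subseteq> all_edges n"
  shows "measure_pmf.prob (gnp n p) {E. F \<subseteq> E} = p ^ card F"
proof -
  have "(\<lambda>f. {e \<in> all_edges n. f e}) -` {E. F \<subseteq> E} = Pi (all_edges n) (\<lambda>e. if e \<in> F then {True} else UNIV)"
    using F by (auto simp: Pi_def split: if_splits)
  then have "measure_pmf.prob (gnp n p) {E. F \<subseteq> E} =
      (\<Prod>e\<in>all_edges n. measure_pmf.prob (bernoulli_pmf p) (if e \<in> F then {True} else UNIV))"
    unfolding gnp_def by (simp add: measure_Pi_pmf_Pi[OF finite_all_edges])
  also have "\<dots> = (\<Prod>e\<in>all_edges n. if e \<in> F then p else 1)"
    using p by (intro prod.cong) (auto simp: measure_pmf_single)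
  also have "\<dots> = (\<Prod>e\<in>F. p)"
    using F finite_all_edges by (subst prod.inter_restrict[symmetric]) (auto simp: Int_absorb1)
  finally show ?thesis by simp
qed

section \<open>Calculus of events that hold with high probability\<close>

lemma whp_of_bound:
  assumes "\<forall>\<^sub>F n in sequentially. measure_pmf.prob (gnp n (p n)) {E. \<not> P n E} \<le> h n" "h \<longlonglongrightarrow> 0"
  shows "whp p P"
proof -
  have eq: "measure_pmf.prob (gnp n (p n)) {E. P n E} = 1 - measure_pmf.prob (gnp n (p n)) {E. \<not> P n E}" for n
    using measure_pmf.prob_compl[of "{E. \<not> P n E}" "gnp n (p n)"]
    by (simp add: Compl_eq_Diff_UNIV[symmetric] Collect_neg_eq)
  have "(\<lambda>n. measure_pmf.prob (gnp n (p n)) {E. \<not> P n E}) \<longlonglongrightarrow> 0"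
    by (rule tendsto_sandwich[OF _ assms(1) tendsto_const assms(2)]) simp
  from tendsto_diff[OF tendsto_const[of 1] this] show ?thesis
    unfolding whp_def eq by simp
qed

lemma whp_mono:
  assumes "whp p P" "\<And>n E. E \<subseteq> all_edges n \<Longrightarrow> P n E \<Longrightarrow> Q n E"
  shows "whp p Q"
proof -
  have le: "measure_pmf.prob (gnp n (p n)) {E. P n E} \<le> measure_pmf.prob (gnp n (p n)) {E. Q n E}" for n
    using assms(2) set_pmf_gnp by (intro measure_pmf.finite_measure_mono_AE) (auto simp: AE_measure_pmf_iff)
  show ?thesis
    unfolding whp_def
    by (rule tendsto_sandwich[OF _ _ assms(1)[unfolded whp_def] tendsto_const]) (auto simp: le)
qed

lemma whp_conj:
  assumes "whp p P" "whp p Q"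
  shows "whp p (\<lambda>n E. P n E \<and> Q n E)"
proof (rule whp_of_bound[OF always_eventually[OF allI]])
  let ?pr = "\<lambda>n. measure_pmf.prob (gnp n (p n))"
  fix n
  have "{E. \<not> (P n E \<and> Q n E)} = {E. \<not> P n E} \<union> {E. \<not> Q n E}" by auto
  then have "?pr n {E. \<not> (P n E \<and> Q n E)} \<le> ?pr n {E. \<not> P n E} + ?pr n {E. \<not> Q n E}"
    by (simp add: measure_Un_le)
  moreover have "?pr n {E. \<not> R n E} = 1 - ?pr n {E. R n E}" for R
    using measure_pmf.prob_compl[of "{E. R n E}" "gnp n (p n)"]
    by (simp add: Compl_eq_Diff_UNIV[symmetric] Collect_neg_eq)
  ultimately show "?pr n {E. \<not> (P n E \<and> Q n E)} \<le> (1 - ?pr n {E. P n E}) + (1 - ?pr n {E. Q n E})"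
    by simp
next
  have "(\<lambda>n. (1 - measure_pmf.prob (gnp n (p n)) {E. P n E}) +
      (1 - measure_pmf.prob (gnp n (p n)) {E. Q n E})) \<longlonglongrightarrow> (1 - 1) + (1 - 1)"
    by (intro tendsto_intros assms[unfolded whp_def])
  then show "(\<lambda>n. (1 - measure_pmf.prob (gnp n (p n)) {E. P n E}) +
      (1 - measure_pmf.prob (gnp n (p n)) {E. Q n E})) \<longlonglongrightarrow> 0" by simp
qed

lemma whp_ball:
  assumes "finite I" "\<And>i. i \<in> I \<Longrightarrow> whp p (P i)"
  shows "whp p (\<lambda>n E. \<forall>i\<in>I. P i n E)"
  using assms
proof (induction I rule: finite_induct)
  case empty
  then show ?case by (simp add: whp_def)
next
  case (insert i I)
  then have "whp p (\<lambda>n E. P i n E \<and> (\<forall>i\<in>I. P i n E))" by (intro whp_conj) auto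
  then show ?case by simp
qed

text \<open>Union bound over the \<open>a\<close>-element sets \<open>W\<close> and the sets
  \<open>F\<close> of exactly \<open>c\<close> edges inside \<open>W\<close>. The factor
  \<open>2 ^ 2 ^ a\<close> crudely bounds the number of choices of \<open>F\<close> independently of
  \<open>n\<close>; the choices of \<open>W\<close> cost \<open>n ^ a\<close>.\<close>

lemma prob_dense_subset_le:
  assumes p: "0 \<le> p" "p \<le> 1"
  shows "measure_pmf.prob (gnp n p) {E. \<exists>W\<subseteq>{0..<n}. card W = a \<and> c \<le> card (induced_edges E W)}
    \<le> 2 ^ 2 ^ a * (real n ^ a * p ^ c)"
proof -
  define Ws where "Ws = {W. W \<subseteq> {0..<n} \<and> card W = a}"
  define Fs where "Fs W = {F. F \<subseteq> Pow W \<and> F \<subseteq> all_edges n \<and> card F = c}" for W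
  have finWs: "finite Ws" by (simp add: Ws_def)
  have finW: "finite W" if "W \<in> Ws" for W using that by (auto simp: Ws_def intro: finite_subset)
  have finFs: "finite (Fs W)" for W
    by (rule finite_subset[of _ "Pow (all_edges n)"]) (auto simp: Fs_def finite_all_edges)
  have "measure_pmf.prob (gnp n p) {E. \<exists>W\<subseteq>{0..<n}. card W = a \<and> c \<le> card (induced_edges E W)}
    \<le> measure_pmf.prob (gnp n p) (\<Union>i\<in>Sigma Ws Fs. {E. snd i \<subseteq> E})"
  proof (rule measure_pmf.finite_measure_mono_AE)
    show "AE E in measure_pmf (gnp n p). E \<in> {E. \<exists>W\<subseteq>{0..<n}. card W = a \<and> c \<le> card (induced_edges E W)}
        \<longrightarrow> E \<in> (\<Union>i\<in>Sigma Ws Fs. {E. snd i \<subseteq> E})"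
      unfolding AE_measure_pmf_iff
    proof (intro ballI impI)
      fix E assume "E \<in> set_pmf (gnp n p)"
        and "E \<in> {E. \<exists>W\<subseteq>{0..<n}. card W = a \<and> c \<le> card (induced_edges E W)}"
      then obtain W where W: "W \<subseteq> {0..<n}" "card W = a" "c \<le> card (induced_edges E W)"
        and E: "E \<subseteq> all_edges n" using set_pmf_gnp by auto
      obtain F where F: "F \<subseteq> induced_edges E W" "card F = c"
        using obtain_subset_with_card_n[OF W(3)] by auto
      then have "(W, F) \<in> Sigma Ws Fs" "F \<subseteq> E"
        using W E by (auto simp: Ws_def Fs_def induced_edges_def)
      then show "E \<in> (\<Union>i\<in>Sigma Ws Fs. {E. snd i \<subseteq> E})" by (intro UN_I[of "(W, F)"]) auto
    qed
  qed simp
  also have "\<dots> \<le> (\<Sum>i\<in>Sigma Ws Fs. measure_pmf.prob (gnp n p) {E. snd i \<subseteq> E})"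
    using finWs finFs by (intro measure_UNION_le) auto
  also have "\<dots> = (\<Sum>i\<in>Sigma Ws Fs. p ^ c)"
    using p by (intro sum.cong) (auto simp: Fs_def prob_gnp_superset)
  also have "\<dots> = real (card (Sigma Ws Fs)) * p ^ c" by simp
  also have "\<dots> \<le> (2 ^ 2 ^ a * real n ^ a) * p ^ c"
  proof (rule mult_right_mono)
    have "card (Fs W) \<le> 2 ^ 2 ^ a" if "W \<in> Ws" for W
    proof -
      have "card (Fs W) \<le> card (Pow (Pow W))"
        using finW[OF that] by (intro card_mono) (auto simp: Fs_def)
      also have "\<dots> = 2 ^ 2 ^ a" using that finW[OF that] by (simp add: card_Pow Ws_def)
      finally show ?thesis .
    qed
    then have "card (Sigma Ws Fs) \<le> (\<Sum>W\<in>Ws. 2 ^ 2 ^ a)"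
      using finWs finFs by (subst card_SigmaI) (simp, simp, rule sum_mono)
    also have "\<dots> = (n choose a) * 2 ^ 2 ^ a" by (simp add: Ws_def n_subsets)
    also have "\<dots> \<le> n ^ a * 2 ^ 2 ^ a"
      using binomial_le_pow[of a n] by (cases "a \<le> n") (auto simp: binomial_eq_0)
    finally have "real (card (Sigma Ws Fs)) \<le> real (n ^ a * 2 ^ 2 ^ a)" by (simp only: of_nat_le_iff)
    then show "real (card (Sigma Ws Fs)) \<le> 2 ^ 2 ^ a * real n ^ a" by (simp add: mult.commute)
  qed (use p in simp)
  finally show ?thesis by (simp add: mult.assoc)
qed

lemma whp_no_dense_subset:
  assumes p: "\<And>n. 0 \<le> p n \<and> p n \<le> 1" and lim: "(\<lambda>n. real n ^ a * p n ^ c) \<longlonglongrightarrow> 0"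
  shows "whp p (\<lambda>n E. \<forall>W\<subseteq>{0..<n}. card W = a \<longrightarrow> card (induced_edges E W) < c)"
proof (rule whp_of_bound[OF always_eventually[OF allI]])
  fix n :: nat
  have "{E. \<not> (\<forall>W\<subseteq>{0..<n}. card W = a \<longrightarrow> card (induced_edges E W) < c)} =
      {E. \<exists>W\<subseteq>{0..<n}. card W = a \<and> c \<le> card (induced_edges E W)}" by (auto simp: not_less)
  then show "measure_pmf.prob (gnp n (p n)) {E. \<not> (\<forall>W\<subseteq>{0..<n}. card W = a \<longrightarrow> card (induced_edges E W) < c)}
      \<le> 2 ^ 2 ^ a * (real n ^ a * p n ^ c)"
    using prob_dense_subset_le[of "p n" n a c] p by simp
next
  show "(\<lambda>n. 2 ^ 2 ^ a * (real n ^ a * p n ^ c)) \<longlonglongrightarrow> 0"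
    using tendsto_mult_right_zero[OF lim] .
qed

text \<open>Chebyshev's inequality for the number \<open>X\<close> of events that occur:
  \<open>X = 0\<close> deviates from the mean \<open>\<mu>\<close> by \<open>\<mu>\<close>, and the
  last assumption bounds the variance by \<open>\<delta> * \<mu>\<^sup>2\<close>.\<close>

lemma second_moment_pmf:
  fixes D :: "'a pmf"
  assumes fin: "finite I" and \<mu>: "\<mu> = (\<Sum>i\<in>I. measure_pmf.prob D (A i))" "\<mu> > 0"
    and le: "(\<Sum>i\<in>I. \<Sum>j\<in>I. measure_pmf.prob D (A i \<inter> A j)) \<le> \<mu>\<^sup>2 * (1 + \<delta>)"
  shows "measure_pmf.prob D {x. \<forall>i\<in>I. x \<notin> A i} \<le> \<delta>"
proof -
  define X :: "'a \<Rightarrow> real" where "X x = (\<Sum>i\<in>I. indicator (A i) x)" for x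
  have int1: "integrable (measure_pmf D) (indicator S :: 'a \<Rightarrow> real)" for S
    by (rule measure_pmf.integrable_const_bound[where B = 1]) auto
  have EX: "measure_pmf.expectation D X = \<mu>"
    unfolding X_def \<mu>(1) by (subst Bochner_Integration.integral_sum) (auto simp: int1)
  have X2: "(X x)\<^sup>2 = (\<Sum>i\<in>I. \<Sum>j\<in>I. indicator (A i \<inter> A j) x)" for x
    unfolding X_def power2_eq_square sum_product by (simp add: indicator_inter_arith)
  have intX: "integrable (measure_pmf D) X" unfolding X_def using int1 by auto
  have intX2: "integrable (measure_pmf D) (\<lambda>x. (X x)\<^sup>2)" unfolding X2
    by (intro Bochner_Integration.integrable_sum int1)
  have EX2: "measure_pmf.expectation D (\<lambda>x. (X x)\<^sup>2) = (\<Sum>i\<in>I. \<Sum>j\<in>I. measure_pmf.prob D (A i \<inter> A j))"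
    unfolding X2 by (simp add: Bochner_Integration.integral_sum Bochner_Integration.integrable_sum int1)
  have "measure_pmf.prob D {x. \<forall>i\<in>I. x \<notin> A i} \<le> measure_pmf.prob D {x. \<bar>X x - \<mu>\<bar> \<ge> \<mu>}"
    using \<mu>(2) by (intro measure_pmf.finite_measure_mono) (auto simp: X_def)
  also have "\<dots> \<le> measure_pmf.variance D X / \<mu>\<^sup>2"
    using measure_pmf.Chebyshev_inequality[of X D \<mu>] intX2 \<mu>(2) EX by simp
  also have "measure_pmf.variance D X = measure_pmf.expectation D (\<lambda>x. (X x)\<^sup>2) - \<mu>\<^sup>2"
    using measure_pmf.variance_eq[OF intX intX2] EX by simp
  also have "\<dots> / \<mu>\<^sup>2 \<le> \<delta>"
    using le \<mu>(2) unfolding EX2 by (simp add: field_simps)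
  finally show ?thesis .
qed

text \<open>Only transversal copies are counted: the vertex \<open>u\<close> is mapped into its own part \<open>Q u\<close>, so that two
  copies can share an edge only if it is the image of the same edge of the fixed graph.\<close>
lemma prob_no_copy_le:
  fixes U :: "'u set"
  assumes g: "graph U EF" and p: "0 < p" "p \<le> 1" and m: "0 < m"
    and Q: "\<And>u. u \<in> U \<Longrightarrow> Q u \<subseteq> {0..<n} \<and> card (Q u) = m"
    and disj: "\<And>u w x. u \<in> U \<Longrightarrow> w \<in> U \<Longrightarrow> x \<in> Q u \<Longrightarrow> x \<in> Q w \<Longrightarrow> u = w"
  shows "measure_pmf.prob (gnp n p) {E. \<not> has_copy E U EF {0..<n}} \<le>
    (\<Sum>T | T \<subseteq> U \<and> induced_edges EF T \<noteq> {}. 1 / (real m ^ card T * p ^ card (induced_edges EF T)))"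
    (is "_ \<le> ?\<delta>")
proof -
  \<comment> \<open>Extensional maps with one value per part: there are \<open>m ^ t\<close> of
    them, and fixing the values on \<open>T\<close> divides this number by
    \<open>m ^ card T\<close>.\<close>
  define \<Phi> where "\<Phi> = PiE U Q"
  define im where "im \<phi> = (\<lambda>e. \<phi> ` e) ` EF" for \<phi> :: "'u \<Rightarrow> nat"
  define c where "c = card EF"
  define t where "t = card U"
  define \<T> where "\<T> = {T. T \<subseteq> U \<and> induced_edges EF T \<noteq> {}}"
  have finU: "finite U" using g by (simp add: graph_def)
  have finE: "finite EF" using g by (rule graph_finite_edges)
  have finQ: "finite (Q u)" if "u \<in> U" for u using Q[OF that] by (auto intro: finite_subset)
  have fin\<Phi>: "finite \<Phi>" unfolding \<Phi>_def using finU finQ by (intro finite_PiE) auto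
  have card\<Phi>: "card \<Phi> = m ^ t" unfolding \<Phi>_def t_def using finU Q by (simp add: card_PiE)
  have fin\<T>: "finite \<T>" unfolding \<T>_def using finU by simp
  have \<Phi>Q: "\<phi> u \<in> Q u" if "\<phi> \<in> \<Phi>" "u \<in> U" for \<phi> u using that by (auto simp: \<Phi>_def)
  have cross: "u = w" if "\<phi> \<in> \<Phi>" "\<psi> \<in> \<Phi>" "u \<in> U" "w \<in> U" "\<phi> u = \<psi> w" for \<phi> \<psi> u w
    using disj[OF that(3,4)] \<Phi>Q that by metis
  have inj: "inj_on \<phi> U" if "\<phi> \<in> \<Phi>" for \<phi> using cross that by (auto intro: inj_onI)
  have EU: "EF \<subseteq> Pow U" using g by (auto simp: graph_def)
  have im_edges: "im \<phi> \<subseteq> all_edges n" if \<phi>: "\<phi> \<in> \<Phi>" for \<phi>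
  proof
    fix s assume "s \<in> im \<phi>"
    then obtain e where e: "e \<in> EF" "s = \<phi> ` e" by (auto simp: im_def)
    then obtain x y where xy: "x \<noteq> y" "x \<in> U" "y \<in> U" "e = {x, y}" using g unfolding graph_def by blast
    have "\<phi> x \<noteq> \<phi> y" using inj[OF \<phi>] xy by (auto dest: inj_onD)
    moreover have "\<phi> x < n" "\<phi> y < n" using \<Phi>Q[OF \<phi>] Q xy by fastforce+
    ultimately show "s \<in> all_edges n" using e xy by (simp add: doubleton_all_edges)
  qed
  have card_im: "card (im \<phi>) = c" if \<phi>: "\<phi> \<in> \<Phi>" for \<phi>
  proof -
    have "inj_on ((`) \<phi>) EF" using inj_on_image_Pow[OF inj[OF \<phi>]] EU by (rule inj_on_subset)
    then show ?thesis unfolding im_def c_def by (rule card_image)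
  qed
  have finim: "finite (im \<phi>)" for \<phi> using finE by (simp add: im_def)
  define A where "A \<phi> = {E. im \<phi> \<subseteq> E}" for \<phi>
  define agree where "agree \<phi> \<psi> = {u \<in> U. \<phi> u = \<psi> u}" for \<phi> \<psi> :: "'u \<Rightarrow> nat"
  \<comment> \<open>Bounds the factor by which two copies agreeing exactly on \<open>T\<close> are
    more likely to appear together than independent ones.\<close>
  define w where "w T = 1 / p ^ card (induced_edges EF T)" for T
  have w0: "w T \<ge> 0" for T using p by (simp add: w_def)
  have prA: "measure_pmf.prob (gnp n p) (A \<phi>) = p ^ c" if "\<phi> \<in> \<Phi>" for \<phi>
    unfolding A_def using prob_gnp_superset im_edges[OF that] card_im[OF that] p by simp
  have prAA: "measure_pmf.prob (gnp n p) (A \<phi> \<inter> A \<psi>) \<le> p ^ (2 * c) * w (agree \<phi> \<psi>)"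
    if \<phi>: "\<phi> \<in> \<Phi>" and \<psi>: "\<psi> \<in> \<Phi>" for \<phi> \<psi>
  proof -
    let ?k = "card (induced_edges EF (agree \<phi> \<psi>))"
    have "A \<phi> \<inter> A \<psi> = {E. im \<phi> \<union> im \<psi> \<subseteq> E}" by (auto simp: A_def)
    then have eq: "measure_pmf.prob (gnp n p) (A \<phi> \<inter> A \<psi>) = p ^ card (im \<phi> \<union> im \<psi>)"
      using prob_gnp_superset[of p "im \<phi> \<union> im \<psi>" n] im_edges[OF \<phi>] im_edges[OF \<psi>] p by simp
    have "im \<phi> \<inter> im \<psi> \<subseteq> (\<lambda>e. \<phi> ` e) ` induced_edges EF (agree \<phi> \<psi>)"
    proof
      fix s assume "s \<in> im \<phi> \<inter> im \<psi>"
      then obtain e e' where e: "e \<in> EF" "e' \<in> EF" "s = \<phi> ` e" "\<phi> ` e = \<psi> ` e'" by (auto simp: im_def)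
      have "e \<subseteq> agree \<phi> \<psi>"
      proof
        fix u assume u: "u \<in> e"
        then obtain u' where u': "u' \<in> e'" "\<phi> u = \<psi> u'" using e(4) by (metis imageE imageI)
        have "u \<in> U" "u' \<in> U" using u u' e EU by auto
        then have "u = u'" using cross[OF \<phi> \<psi>] u' by blast
        then show "u \<in> agree \<phi> \<psi>" using u' \<open>u \<in> U\<close> by (simp add: agree_def)
      qed
      then show "s \<in> (\<lambda>e. \<phi> ` e) ` induced_edges EF (agree \<phi> \<psi>)"
        unfolding e(3) using e(1) by (intro imageI) (simp add: induced_edges_def)
    qed
    moreover have finI: "finite (induced_edges EF (agree \<phi> \<psi>))" using finE by (simp add: induced_edges_def)
    ultimately have "card (im \<phi> \<inter> im \<psi>) \<le> ?k"
      by (meson card_image_le card_mono finite_imageI le_trans)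
    moreover have "card (im \<phi> \<union> im \<psi>) + card (im \<phi> \<inter> im \<psi>) = 2 * c"
      using card_Un_Int[of "im \<phi>" "im \<psi>"] finim card_im[OF \<phi>] card_im[OF \<psi>] by simp
    ultimately have "2 * c \<le> card (im \<phi> \<union> im \<psi>) + ?k" by linarith
    then have "p ^ (card (im \<phi> \<union> im \<psi>) + ?k) \<le> p ^ (2 * c)"
      using p by (intro power_decreasing) auto
    then have "p ^ card (im \<phi> \<union> im \<psi>) * p ^ ?k \<le> p ^ (2 * c)" by (simp add: power_add)
    then show ?thesis unfolding eq w_def using p by (simp add: field_simps)
  qed
  \<comment> \<open>The exact agreement set is replaced by all \<open>T\<close> contained in it,
    because the maps \<open>\<psi>\<close> with \<open>T \<subseteq> agree \<phi> \<psi>\<close> are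
    counted by a plain product. If no edge lies in the agreement set, the summand 1 is
    enough.\<close>
  have w_le: "w (agree \<phi> \<psi>) \<le> 1 + (\<Sum>T\<in>\<T>. if T \<subseteq> agree \<phi> \<psi> then w T else 0)" for \<phi> \<psi>
  proof (cases "agree \<phi> \<psi> \<in> \<T>")
    case True
    have "(if agree \<phi> \<psi> \<subseteq> agree \<phi> \<psi> then w (agree \<phi> \<psi>) else 0) \<le> (\<Sum>T\<in>\<T>. if T \<subseteq> agree \<phi> \<psi> then w T else 0)"
      using fin\<T> True w0 by (intro member_le_sum) auto
    then show ?thesis by simp
  next
    case False
    then have "induced_edges EF (agree \<phi> \<psi>) = {}" by (auto simp: \<T>_def agree_def)
    then have "w (agree \<phi> \<psi>) = 1" by (simp add: w_def)
    moreover have "(\<Sum>T\<in>\<T>. if T \<subseteq> agree \<phi> \<psi> then w T else 0) \<ge> 0"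
      using w0 by (intro sum_nonneg) auto
    ultimately show ?thesis by simp
  qed
  have count: "(\<Sum>\<psi>\<in>\<Phi>. if T \<subseteq> agree \<phi> \<psi> then w T else 0) = w T * (real m ^ t / real m ^ card T)"
    if \<phi>: "\<phi> \<in> \<Phi>" and T: "T \<in> \<T>" for \<phi> T
  proof -
    have TU: "T \<subseteq> U" using T by (simp add: \<T>_def)
    have "{\<psi> \<in> \<Phi>. T \<subseteq> agree \<phi> \<psi>} = PiE U (\<lambda>u. if u \<in> T then {\<phi> u} else Q u)"
    proof (intro set_eqI iffI)
      fix \<psi> assume "\<psi> \<in> {\<psi> \<in> \<Phi>. T \<subseteq> agree \<phi> \<psi>}"
      then have a: "\<psi> \<in> PiE U Q" "\<And>u. u \<in> T \<Longrightarrow> \<phi> u = \<psi> u" by (auto simp: \<Phi>_def agree_def)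
      show "\<psi> \<in> PiE U (\<lambda>u. if u \<in> T then {\<phi> u} else Q u)"
        using a by (intro PiE_I) (auto dest: PiE_mem PiE_arb)
    next
      fix \<psi> assume a: "\<psi> \<in> PiE U (\<lambda>u. if u \<in> T then {\<phi> u} else Q u)"
      have ag: "\<psi> u = \<phi> u" if "u \<in> T" for u using PiE_mem[OF a, of u] that TU by auto
      have "\<psi> u \<in> Q u" if "u \<in> U" for u
        using PiE_mem[OF a that] \<Phi>Q[OF \<phi> that] by (auto split: if_splits)
      then have "\<psi> \<in> \<Phi>" unfolding \<Phi>_def using PiE_arb[OF a] by (intro PiE_I) auto
      then show "\<psi> \<in> {\<psi> \<in> \<Phi>. T \<subseteq> agree \<phi> \<psi>}" using ag TU by (auto simp: agree_def)
    qed
    then have "card {\<psi> \<in> \<Phi>. T \<subseteq> agree \<phi> \<psi>} = (\<Prod>u\<in>U. card (if u \<in> T then {\<phi> u} else Q u))"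
      using finU by (simp add: card_PiE)
    also have "\<dots> = (\<Prod>u\<in>U. if u \<in> T then 1 else m)" using Q by (intro prod.cong) auto
    also have "\<dots> = m ^ (t - card T)"
    proof -
      have "(\<Prod>u\<in>U. if u \<in> T then 1 else m) = (\<Prod>u\<in>U - T. if u \<in> T then 1 else m)"
        using finU by (intro prod.mono_neutral_right) auto
      also have "\<dots> = m ^ card (U - T)" by simp
      finally show ?thesis using TU finU by (simp add: card_Diff_subset finite_subset t_def)
    qed
    finally have "real (card {\<psi> \<in> \<Phi>. T \<subseteq> agree \<phi> \<psi>}) = real m ^ (t - card T)" by simp
    also have "\<dots> = real m ^ t / real m ^ card T"
      using m TU finU by (intro power_diff) (auto simp: t_def card_mono)
    finally have "real (card {\<psi> \<in> \<Phi>. T \<subseteq> agree \<phi> \<psi>}) = real m ^ t / real m ^ card T" .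
    then show ?thesis
      using fin\<Phi> by (simp add: sum.If_cases Int_def)
  qed
  define \<mu> where "\<mu> = (\<Sum>\<phi>\<in>\<Phi>. measure_pmf.prob (gnp n p) (A \<phi>))"
  have \<mu>: "\<mu> = real m ^ t * p ^ c" by (simp add: \<mu>_def prA card\<Phi>)
  have \<mu>0: "\<mu> > 0" using m p by (simp add: \<mu>)
  have \<delta>: "?\<delta> = (\<Sum>T\<in>\<T>. w T / real m ^ card T)"
    unfolding \<T>_def w_def by (intro sum.cong) (auto simp: mult.commute)
  have "(\<Sum>\<phi>\<in>\<Phi>. \<Sum>\<psi>\<in>\<Phi>. measure_pmf.prob (gnp n p) (A \<phi> \<inter> A \<psi>))
      \<le> (\<Sum>\<phi>\<in>\<Phi>. \<Sum>\<psi>\<in>\<Phi>. p ^ (2 * c) * (1 + (\<Sum>T\<in>\<T>. if T \<subseteq> agree \<phi> \<psi> then w T else 0)))"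
  proof (intro sum_mono)
    fix \<phi> \<psi> assume "\<phi> \<in> \<Phi>" "\<psi> \<in> \<Phi>"
    then have "measure_pmf.prob (gnp n p) (A \<phi> \<inter> A \<psi>) \<le> p ^ (2 * c) * w (agree \<phi> \<psi>)" by (rule prAA)
    also have "\<dots> \<le> p ^ (2 * c) * (1 + (\<Sum>T\<in>\<T>. if T \<subseteq> agree \<phi> \<psi> then w T else 0))"
      using p by (intro mult_left_mono w_le) auto
    finally show "measure_pmf.prob (gnp n p) (A \<phi> \<inter> A \<psi>)
      \<le> p ^ (2 * c) * (1 + (\<Sum>T\<in>\<T>. if T \<subseteq> agree \<phi> \<psi> then w T else 0))" .
  qed
  also have "\<dots> = (\<Sum>\<phi>\<in>\<Phi>. p ^ (2 * c) * (real m ^ t + (\<Sum>T\<in>\<T>. w T * (real m ^ t / real m ^ card T))))"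
  proof (intro sum.cong refl)
    fix \<phi> assume \<phi>: "\<phi> \<in> \<Phi>"
    have "(\<Sum>\<psi>\<in>\<Phi>. \<Sum>T\<in>\<T>. if T \<subseteq> agree \<phi> \<psi> then w T else 0) = (\<Sum>T\<in>\<T>. w T * (real m ^ t / real m ^ card T))"
      by (subst sum.swap) (intro sum.cong refl count[OF \<phi>])
    then show "(\<Sum>\<psi>\<in>\<Phi>. p ^ (2 * c) * (1 + (\<Sum>T\<in>\<T>. if T \<subseteq> agree \<phi> \<psi> then w T else 0))) =
        p ^ (2 * c) * (real m ^ t + (\<Sum>T\<in>\<T>. w T * (real m ^ t / real m ^ card T)))"
      by (simp add: sum_distrib_left[symmetric] sum.distrib card\<Phi>)
  qed
  also have "\<dots> = real m ^ t * (p ^ (2 * c) * (real m ^ t + real m ^ t * (\<Sum>T\<in>\<T>. w T / real m ^ card T)))"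
    by (simp add: card\<Phi> sum_distrib_left mult.commute)
  also have "\<dots> = \<mu>\<^sup>2 * (1 + ?\<delta>)"
    unfolding \<mu> \<delta> by (simp add: power2_eq_square mult_2 power_add) (simp add: algebra_simps)
  finally have "measure_pmf.prob (gnp n p) {E. \<forall>\<phi>\<in>\<Phi>. E \<notin> A \<phi>} \<le> ?\<delta>"
    using fin\<Phi> \<mu>_def \<mu>0 by (intro second_moment_pmf[of \<Phi> \<mu>])
  moreover have "measure_pmf.prob (gnp n p) {E. \<not> has_copy E U EF {0..<n}}
      \<le> measure_pmf.prob (gnp n p) {E. \<forall>\<phi>\<in>\<Phi>. E \<notin> A \<phi>}"
  proof (intro measure_pmf.finite_measure_mono subsetI CollectI ballI notI)
    fix E \<phi> assume E: "E \<in> {E. \<not> has_copy E U EF {0..<n}}" and \<phi>: "\<phi> \<in> \<Phi>" and A: "E \<in> A \<phi>"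
    have "\<phi> ` U \<subseteq> {0..<n}" using \<Phi>Q[OF \<phi>] Q by blast
    moreover have "{\<phi> x, \<phi> y} \<in> E" if "{x, y} \<in> EF" for x y
    proof -
      have "\<phi> ` {x, y} \<in> im \<phi>" unfolding im_def using that by (rule imageI)
      then show ?thesis using A by (auto simp: A_def)
    qed
    ultimately have "has_copy E U EF {0..<n}" unfolding has_copy_def using inj[OF \<phi>] by blast
    then show False using E by simp
  qed simp
  ultimately show ?thesis by linarith
qed

text \<open>The quotient \<open>r\<close> of \<open>n^(-v/e)\<close> and \<open>p\<close> tends to
  0, and the density assumption makes the summand for \<open>T\<close> at most a constant times
  \<open>r\<close> to the number of edges in \<open>T\<close>. That number is positive for the sets
  summed over, so the bound of \<open>prob_no_copy_le\<close> vanishes.\<close>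

lemma whp_has_copy:
  fixes U :: "'u set" and v e :: nat
  assumes g: "graph U EF" and p: "\<And>n. 0 \<le> p n \<and> p n \<le> 1" and e: "0 < e"
    and dens: "\<And>S. S \<subseteq> U \<Longrightarrow> v * card (induced_edges EF S) \<le> e * card S"
    and lim: "(\<lambda>n. real n powr (- real v / real e)) \<in> o(p)"
  shows "whp p (\<lambda>n E. has_copy E U EF {0..<n})"
proof -
  have finU: "finite U" using g by (simp add: graph_def)
  \<comment> \<open>Blocks of length \<open>n div d\<close> leave room for \<open>card U\<close>
    disjoint ones below \<open>n\<close>; \<open>Suc\<close> keeps \<open>d\<close> positive for
    empty \<open>U\<close>.\<close>
  define d where "d = Suc (card U)"
  define m where "m n = n div d" for n
  define r where "r n = real n powr (- real v / real e) / p n" for n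
  have r0: "r \<longlonglongrightarrow> 0" unfolding r_def using lim by (rule smalloD_tendsto)
  obtain h where h: "bij_betw h U {0..<card U}" using ex_bij_betw_finite_nat[OF finU] by blast
  define Q where "Q n u = {h u * m n ..< Suc (h u) * m n}" for n u
  let ?\<T> = "{T. T \<subseteq> U \<and> induced_edges EF T \<noteq> {}}"
  let ?bd = "\<lambda>n. \<Sum>T\<in>?\<T>. (2 * real d) ^ card T * r n ^ card (induced_edges EF T)"
  have lt: "h u < card U" if "u \<in> U" for u using h that by (auto simp: bij_betw_def)
  \<comment> \<open>Small-o with constant 1 already forces \<open>p n > 0\<close> for large
    \<open>n\<close>, so dividing by \<open>p n\<close> is safe there.\<close>
  have "\<forall>\<^sub>F n in sequentially. norm (real n powr (- real v / real e)) \<le> 1 * norm (p n)"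
    using landau_o.smallD[OF lim, of 1] by simp
  then have ev: "\<forall>\<^sub>F n in sequentially. 2 * d \<le> n \<and> p n > 0"
    using eventually_ge_at_top[of "2 * d"]
  proof eventually_elim
    case (elim n)
    have "real n powr (- real v / real e) > 0" using elim(2) by (simp add: d_def)
    moreover have "p n \<ge> real n powr (- real v / real e)" using elim(1) p[of n] by simp
    ultimately have "p n > 0" by linarith
    then show ?case using elim(2) by simp
  qed
  show ?thesis
  proof (rule whp_of_bound)
    show "\<forall>\<^sub>F n in sequentially. measure_pmf.prob (gnp n (p n)) {E. \<not> has_copy E U EF {0..<n}} \<le> ?bd n"
      using ev
    proof eventually_elim
      case (elim n)
      then have n: "2 * d \<le> n" and p0: "p n > 0" by auto
      have d0: "d > 0" by (simp add: d_def)
      have n0: "real n \<ge> 1" using n d0 by linarith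
      have m0: "m n > 0" unfolding m_def using n d0 by (simp add: div_greater_zero_iff)
      \<comment> \<open>Rounding in \<open>n div d\<close> costs at most a factor 2 because the
        quotient is at least 1.\<close>
      have mn: "real n / (2 * real d) \<le> real (m n)"
      proof -
        have "n < d * (m n + 1)" unfolding m_def using dividend_less_div_times[of d n] d0 by (simp add: mult.commute)
        also have "\<dots> \<le> d * (2 * m n)" using m0 by (intro mult_le_mono2) simp
        finally have "real n \<le> real (d * (2 * m n))" by (simp only: of_nat_le_iff less_imp_le)
        then show ?thesis using d0 by (simp add: field_simps)
      qed
      have "measure_pmf.prob (gnp n (p n)) {E. \<not> has_copy E U EF {0..<n}} \<le>
          (\<Sum>T\<in>?\<T>. 1 / (real (m n) ^ card T * p n ^ card (induced_edges EF T)))"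
      proof (rule prob_no_copy_le[OF g p0 _ m0])
        show "p n \<le> 1" using p by simp
        show "Q n u \<subseteq> {0..<n} \<and> card (Q n u) = m n" if "u \<in> U" for u
        proof -
          have "Suc (h u) * m n \<le> d * m n" using lt[OF that] by (intro mult_le_mono1) (simp add: d_def)
          also have "\<dots> \<le> n" by (simp add: m_def)
          finally show ?thesis by (auto simp: Q_def)
        qed
        fix u w x assume u: "u \<in> U" "w \<in> U" "x \<in> Q n u" "x \<in> Q n w"
        have "x div m n = h u" "x div m n = h w"
          using u by (auto intro!: div_nat_eqI simp: Q_def mult.commute)
        then show "u = w" using h u by (auto simp: bij_betw_def dest: inj_onD)
      qed
      also have "\<dots> \<le> ?bd n"
      proof (rule sum_mono)
        fix T assume "T \<in> ?\<T>"
        then have TU: "T \<subseteq> U" by simp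
        let ?s = "card T" and ?k = "card (induced_edges EF T)"
        have "real v / real e * real ?k \<le> real ?s"
        proof -
          have "real (v * ?k) \<le> real (e * ?s)" using dens[OF TU] by (simp only: of_nat_le_iff)
          then show ?thesis using e by (simp add: field_simps)
        qed
        then have "(real n powr (real v / real e)) ^ ?k \<le> real n powr real ?s"
          using n0 by (subst powr_power) (auto intro!: powr_mono simp: mult.commute)
        also have "\<dots> = real n ^ ?s" using n0 by (simp add: powr_realpow)
        also have "\<dots> = (2 * real d) ^ ?s * (real n / (2 * real d)) ^ ?s"
          using d0 by (subst power_mult_distrib[symmetric]) simp
        also have "\<dots> \<le> (2 * real d) ^ ?s * real (m n) ^ ?s"
          using mn by (intro mult_left_mono power_mono) auto
        finally have le: "(real n powr (real v / real e)) ^ ?k \<le> (2 * real d) ^ ?s * real (m n) ^ ?s" .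
        have r: "r n = 1 / (real n powr (real v / real e) * p n)"
          by (simp add: r_def powr_minus field_simps)
        have pos: "real n powr (real v / real e) > 0" using n0 by simp
        have "1 / (real (m n) ^ ?s * p n ^ ?k) \<le> (2 * real d) ^ ?s / ((real n powr (real v / real e)) ^ ?k * p n ^ ?k)"
          using le p0 pos m0 by (simp add: field_simps)
        then show "1 / (real (m n) ^ ?s * p n ^ ?k) \<le> (2 * real d) ^ ?s * r n ^ ?k"
          unfolding r by (simp add: power_divide power_mult_distrib)
      qed
      finally show ?case .
    qed
    have "?bd \<longlonglongrightarrow> (\<Sum>T\<in>?\<T>. (2 * real d) ^ card T * 0 ^ card (induced_edges EF T))"
      by (intro tendsto_intros r0)
    also have "(\<Sum>T\<in>?\<T>. (2 * real d) ^ card T * 0 ^ card (induced_edges EF T)) = 0"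
    proof (intro sum.neutral ballI)
      fix T assume "T \<in> ?\<T>"
      then have "T \<subseteq> U" "induced_edges EF T \<noteq> {}" by auto
      then have "card (induced_edges EF T) \<noteq> 0"
        using finite_induced_edges[of T EF] finU by (auto dest: finite_subset)
      then show "(2 * real d) ^ card T * 0 ^ card (induced_edges EF T) = 0" by (simp add: power_0_left)
    qed
    finally show "?bd \<longlonglongrightarrow> 0" .
  qed
qed

text \<open>Both limits come from \<open>q = p * n^(v/e)\<close>, which tends to 0:
  \<open>q ^ e\<close> is the first sequence, and \<open>v / e >= 1\<close> gives
  \<open>n * p <= q\<close>. The first excludes \<open>v\<close> vertices with \<open>e\<close>
  edges, the second \<open>l\<close> vertices with \<open>l\<close> edges.\<close>

lemma sparse_limits:
  fixes v e :: nat
  assumes p: "\<And>n. 0 \<le> p n \<and> p n \<le> 1" and e: "0 < e" "e \<le> v"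
    and lim: "p \<in> o(\<lambda>n. real n powr (- real v / real e))"
  shows "(\<lambda>n. real n ^ v * p n ^ e) \<longlonglongrightarrow> 0"
    and "0 < l \<Longrightarrow> (\<lambda>n. real n ^ l * p n ^ l) \<longlonglongrightarrow> 0"
proof -
  define q where "q n = p n / real n powr (- real v / real e)" for n
  have q0: "q \<longlonglongrightarrow> 0" unfolding q_def using lim by (rule smalloD_tendsto)
  have q: "q n = p n * real n powr (real v / real e)" for n
    by (simp add: q_def powr_minus field_simps)
  have "q n ^ e = real n ^ v * p n ^ e" if "n > 0" for n
    using that e by (simp add: q power_mult_distrib powr_power powr_realpow)
  then have ev: "\<forall>\<^sub>F n in sequentially. q n ^ e = real n ^ v * p n ^ e"
    using eventually_gt_at_top[of 0] by (rule eventually_mono[rotated])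
  have "(\<lambda>n. q n ^ e) \<longlonglongrightarrow> 0" using tendsto_power[OF q0, of e] e by (simp add: power_0_left)
  then show "(\<lambda>n. real n ^ v * p n ^ e) \<longlonglongrightarrow> 0" using ev by (rule Lim_transform_eventually)
  have "real n * p n \<le> q n" if "n > 0" for n
  proof -
    have "real n powr 1 \<le> real n powr (real v / real e)"
      using that e by (intro powr_mono) auto
    then have "p n * real n \<le> p n * real n powr (real v / real e)"
      using p[of n] that by (intro mult_left_mono) auto
    then show ?thesis by (simp add: q mult.commute)
  qed
  then have "\<forall>\<^sub>F n in sequentially. real n * p n \<le> q n"
    using eventually_gt_at_top[of 0] by (rule eventually_mono[rotated])
  then have "(\<lambda>n. real n * p n) \<longlonglongrightarrow> 0"
    by (rule tendsto_sandwich[OF always_eventually _ tendsto_const q0, rotated]) (use p in simp)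
  then have "(\<lambda>n. (real n * p n) ^ l) \<longlonglongrightarrow> 0 ^ l" by (rule tendsto_power)
  then show "0 < l \<Longrightarrow> (\<lambda>n. real n ^ l * p n ^ l) \<longlonglongrightarrow> 0"
    by (simp add: power_mult_distrib power_0_left)
qed

section \<open>The threshold\<close>

text \<open>The inequality holds inside each tree by acyclicity and the bound on its size; the tag
  \<open>i\<close> keeps the trees disjoint, so it adds up over them.\<close>

lemma small_density_disjoint_trees:
  fixes VT :: "'i \<Rightarrow> 'a set"
  assumes fin: "finite I" and tr: "\<And>i. i \<in> I \<Longrightarrow> tree (VT i) (ET i) \<and> card (VT i) \<le> Suc e"
    and EF: "EF = (\<Union>i\<in>I. (\<lambda>s. Pair i ` s) ` ET i)"
  shows "graph (Sigma I VT) EF"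
    and "S \<subseteq> Sigma I VT \<Longrightarrow> Suc e * card (induced_edges EF S) \<le> e * card S"
proof -
  have g: "graph (VT i) (ET i)" "\<not> has_cycle (VT i) (ET i)" if "i \<in> I" for i
    using tr[OF that] by (auto simp: tree_def)
  have finV: "finite (VT i)" if "i \<in> I" for i using g(1)[OF that] by (simp add: graph_def)
  show "graph (Sigma I VT) EF"
    unfolding graph_def
  proof (intro conjI ballI)
    show "finite (Sigma I VT)" using fin finV by auto
    fix s assume "s \<in> EF"
    then obtain i s' where i: "i \<in> I" "s' \<in> ET i" "s = Pair i ` s'" by (auto simp: EF)
    then obtain x y where "x \<noteq> y" "x \<in> VT i" "y \<in> VT i" "s' = {x, y}"
      using g(1)[OF i(1)] unfolding graph_def by blast
    then show "\<exists>x y. x \<noteq> y \<and> x \<in> Sigma I VT \<and> y \<in> Sigma I VT \<and> s = {x, y}"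
      using i by (intro exI[of _ "(i, x)"] exI[of _ "(i, y)"]) auto
  qed
  assume S: "S \<subseteq> Sigma I VT"
  define R where "R i = {x. (i, x) \<in> S}" for i
  have RV: "R i \<subseteq> VT i" for i using S by (auto simp: R_def)
  have finR: "finite (R i)" if "i \<in> I" for i using RV finV[OF that] by (rule finite_subset)
  have one: "Suc e * card (induced_edges (ET i) (R i)) \<le> e * card (R i)" if i: "i \<in> I" for i
  proof (cases "R i = {}")
    case True
    have "induced_edges (ET i) (R i) = {}"
      using True g(1)[OF i] by (auto simp: induced_edges_def graph_def)
    then show ?thesis by simp
  next
    case False
    let ?k = "card (induced_edges (ET i) (R i))"
    have "?k < card (R i)" using acyclic_card_edges[OF g[OF i] RV False] .
    moreover have "card (R i) \<le> Suc e"
      using card_mono[OF finV[OF i] RV] tr[OF i] by simp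
    ultimately have "?k \<le> e" by linarith
    \<comment> \<open>This is \<open>?k <= e\<close> with \<open>e * ?k\<close> added on both
      sides.\<close>
    then have "Suc e * ?k \<le> e * Suc ?k" by simp
    also have "\<dots> \<le> e * card (R i)" using \<open>?k < card (R i)\<close> by (intro mult_le_mono2) simp
    finally show ?thesis .
  qed
  have "induced_edges EF S \<subseteq> (\<Union>i\<in>I. (\<lambda>s. Pair i ` s) ` induced_edges (ET i) (R i))"
  proof
    fix s assume "s \<in> induced_edges EF S"
    then obtain i s' where i: "i \<in> I" "s' \<in> ET i" "s = Pair i ` s'" "s \<subseteq> S"
      by (auto simp: EF induced_edges_def)
    then have "s' \<in> induced_edges (ET i) (R i)" by (auto simp: induced_edges_def R_def)
    then show "s \<in> (\<Union>i\<in>I. (\<lambda>s. Pair i ` s) ` induced_edges (ET i) (R i))" using i by blast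
  qed
  then have "card (induced_edges EF S) \<le> card (\<Union>i\<in>I. (\<lambda>s. Pair i ` s) ` induced_edges (ET i) (R i))"
    using fin finR by (intro card_mono finite_UN_I finite_imageI finite_induced_edges)
  also have "\<dots> \<le> (\<Sum>i\<in>I. card ((\<lambda>s. Pair i ` s) ` induced_edges (ET i) (R i)))"
    using fin by (rule card_UN_le)
  also have "\<dots> \<le> (\<Sum>i\<in>I. card (induced_edges (ET i) (R i)))"
    using finR by (intro sum_mono card_image_le finite_induced_edges)
  finally have "Suc e * card (induced_edges EF S) \<le> Suc e * (\<Sum>i\<in>I. card (induced_edges (ET i) (R i)))"
    by (rule mult_le_mono2)
  also have "\<dots> = (\<Sum>i\<in>I. Suc e * card (induced_edges (ET i) (R i)))" by (rule sum_distrib_left)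
  also have "\<dots> \<le> (\<Sum>i\<in>I. e * card (R i))" using one by (intro sum_mono)
  also have "\<dots> = e * card (Sigma I R)" using fin finR by (simp add: sum_distrib_left)
  also have "Sigma I R = S" using S by (auto simp: R_def)
  finally show "Suc e * card (induced_edges EF S) \<le> e * card S" .
qed

section \<open>From copies and sparsity to the outcome of the game\<close>

lemma components_graph:
  assumes "graph VH EH" "C \<in> components VH EH"
  shows "graph C (induced_edges EH C)"
  unfolding graph_def
proof (intro conjI ballI)
  show "finite C" using assms by (auto simp: graph_def components_def)
  fix s assume "s \<in> induced_edges EH C"
  then show "\<exists>x y. x \<noteq> y \<and> x \<in> C \<and> y \<in> C \<and> s = {x, y}"
    using assms(1) unfolding graph_def induced_edges_def by fastforce
qed

lemma finite_components: "finite VH \<Longrightarrow> finite (components VH EH)"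
  by (rule finite_subset[of _ "Pow VH"]) (auto simp: components_def)

text \<open>Following any play of Breaker leads to a full board with a copy. A winning board is
  therefore at least as large as the target graph, which yields \<open>v >= 2\<close> and hence
  \<open>e > 0\<close>.\<close>

lemma maker_win_has_copy: "maker_win V E VH EH b mt M B \<Longrightarrow> M \<subseteq> V \<Longrightarrow> finite V \<Longrightarrow> \<exists>M'\<subseteq>V. has_copy E VH EH M'"
proof (induction rule: maker_win.induct)
  case (mw_end M B mt)
  then show ?case by auto
next
  case (mw_maker v M B)
  then show ?case by auto
next
  case (mw_breaker M B)
  obtain S where "S \<subseteq> V - (M \<union> B)" "card S = min b (card (V - (M \<union> B)))"
    using obtain_subset_with_card_n[of "min b (card (V - (M \<union> B)))" "V - (M \<union> B)"] by auto
  then show ?case using mw_breaker by blast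
qed

lemma maker_wins_of_forest_copy:
  fixes Tmin :: "'b set \<Rightarrow> 't set \<times> 't set set"
  assumes g: "graph VH EH" and b: "b > 0" and finV: "finite V"
    and T: "\<And>C. C \<in> components VH EH \<Longrightarrow> tree (fst (Tmin C)) (snd (Tmin C)) \<and>
      maker_wins_game (fst (Tmin C)) (snd (Tmin C)) C (induced_edges EH C) b True \<and> card (fst (Tmin C)) \<le> v"
    and N: "b + b * (v * card (components VH EH)) < N"
    and I: "I = components VH EH \<times> {..<N}"
    and copy: "has_copy E (Sigma I (\<lambda>i. fst (Tmin (fst i))))
      (\<Union>i\<in>I. (\<lambda>s. Pair i ` s) ` snd (Tmin (fst i))) V"
  shows "maker_wins_game V E VH EH b mf"
proof -
  let ?D = "components VH EH"
  let ?VT = "\<lambda>C. fst (Tmin C)"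
  obtain \<phi> where \<phi>: "inj_on \<phi> (Sigma I (\<lambda>i. ?VT (fst i)))" "\<phi> ` Sigma I (\<lambda>i. ?VT (fst i)) \<subseteq> V"
    "\<And>x y. {x, y} \<in> (\<Union>i\<in>I. (\<lambda>s. Pair i ` s) ` snd (Tmin (fst i))) \<Longrightarrow> {\<phi> x, \<phi> y} \<in> E"
    using copy unfolding has_copy_def by blast
  have finD: "finite ?D" using g by (simp add: finite_components graph_def)
  \<comment> \<open>\<open>B0\<close> is Breaker's opening move, empty if Maker starts; the summand
    \<open>b\<close> in the bound for \<open>N\<close> pays for it.\<close>
  have main: "maker_win V E VH EH b True {} B0" if B0: "B0 \<subseteq> V" "card B0 \<le> b" for B0
  proof -
    have "forces V b (\<lambda>M. M \<subseteq> \<phi> ` Sigma I (\<lambda>i. ?VT (fst i)) \<and>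
           (\<forall>C\<in>?D. \<exists>j<N. has_copy E C (induced_edges EH C) (M \<inter> \<phi> ` ({(C, j)} \<times> ?VT C)))) (v * card ?D) {} B0"
      unfolding I
    proof (rule forces_component_copies[OF finV finD _ _ _ _ _ _ B0 N])
      show "inj_on \<phi> (Sigma (?D \<times> {..<N}) (\<lambda>i. ?VT (fst i)))"
        "\<phi> ` Sigma (?D \<times> {..<N}) (\<lambda>i. ?VT (fst i)) \<subseteq> V" using \<phi>(1,2) by (simp_all only: I)
      show "{\<phi> ((C, j), x), \<phi> ((C, j), y)} \<in> E" if "C \<in> ?D" "j < N" "{x, y} \<in> snd (Tmin C)" for C j x y
      proof (rule \<phi>(3), rule UN_I)
        show "(C, j) \<in> I" using that by (simp add: I)
        show "{((C, j), x), ((C, j), y)} \<in> (\<lambda>s. Pair (C, j) ` s) ` snd (Tmin (fst (C, j)))"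
          using that(3) by (intro image_eqI[of _ _ "{x, y}"]) auto
      qed
    qed (use T components_graph[OF g] in \<open>auto simp: tree_def graph_def maker_wins_game_def\<close>)
    then have "forces V b (has_copy E VH EH) (v * card ?D) {} B0"
      using B0(1)
    proof (rule forces_mono)
      fix M assume M: "M \<subseteq> \<phi> ` Sigma I (\<lambda>i. ?VT (fst i)) \<and>
           (\<forall>C\<in>?D. \<exists>j<N. has_copy E C (induced_edges EH C) (M \<inter> \<phi> ` ({(C, j)} \<times> ?VT C)))"
      then have "\<forall>C\<in>?D. \<exists>j. j < N \<and> has_copy E C (induced_edges EH C) (M \<inter> \<phi> ` ({(C, j)} \<times> ?VT C))" by blast
      from bchoice[OF this] obtain J where J: "\<forall>C\<in>?D. J C < N \<and>
        has_copy E C (induced_edges EH C) (M \<inter> \<phi> ` ({(C, J C)} \<times> ?VT C))" ..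
      show "has_copy E VH EH M"
      proof (rule has_copy_of_components[OF g, where A = "\<lambda>C. M \<inter> \<phi> ` ({(C, J C)} \<times> ?VT C)"])
        fix C D assume CD: "C \<in> ?D" "D \<in> ?D" "C \<noteq> D"
        have "\<phi> ` ({(C, J C)} \<times> ?VT C) \<inter> \<phi> ` ({(D, J D)} \<times> ?VT D) = \<phi> ` (({(C, J C)} \<times> ?VT C) \<inter> ({(D, J D)} \<times> ?VT D))"
          using J CD by (intro inj_on_image_Int[OF \<phi>(1), symmetric]) (auto simp: I)
        also have "\<dots> = {}" using CD by auto
        finally show "M \<inter> \<phi> ` ({(C, J C)} \<times> ?VT C) \<inter> (M \<inter> \<phi> ` ({(D, J D)} \<times> ?VT D)) = {}" by blast
      qed (use J in auto)
    qed simp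
    then show ?thesis by (rule forces_maker_win[OF finV b])
  qed
  show ?thesis
  proof (cases "mf \<or> V = {}")
    case True
    show ?thesis
    proof (cases mf)
      case True
      then show ?thesis using main[of "{}"] by (simp add: maker_wins_game_def)
    next
      case False
      \<comment> \<open>On the empty board nobody moves and \<open>mw_breaker\<close> does not
        apply, so the copy must be there from the start.\<close>
      then have V: "V = {}" using True by simp
      have "has_copy E VH EH {}" using main[of "{}"] V by cases auto
      then show ?thesis using V unfolding maker_wins_game_def by (intro mw_end) auto
    qed
  next
    case False
    then have "maker_win V E VH EH b False {} {}"
      using main by (intro mw_breaker) auto
    then show ?thesis using False by (simp add: maker_wins_game_def)
  qed
qed

text \<open>A component with at least \<open>v\<close> vertices would contain \<open>v\<close>
  vertices spanning at least \<open>v - 1\<close> edges, against \<open>tr\<close>. A cycle lies in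
  one component, so its length is below \<open>v\<close> and \<open>cyc\<close> excludes it. All
  components are thus trees too small for Maker to win \<open>C\<close> there.\<close>

lemma breaker_wins_of_sparse:
  assumes E: "E \<subseteq> all_edges n" and gH: "graph VH EH" and b: "b > 0" and C: "C \<in> components VH EH"
    and min: "\<And>(VT :: nat set) ET. tree VT ET \<Longrightarrow> maker_wins_game VT ET C (induced_edges EH C) b True \<Longrightarrow> v \<le> card VT"
    and v: "0 < v"
    and tr: "\<forall>W\<subseteq>{0..<n}. card W = v \<longrightarrow> card (induced_edges E W) < v - 1"
    and cyc: "\<forall>l\<in>{1..<v}. \<forall>W\<subseteq>{0..<n}. card W = l \<longrightarrow> card (induced_edges E W) < l"
  shows "breaker_wins_game {0..<n} E VH EH b mf"
proof -
  have g: "graph {0..<n} E" using E by (rule graph_all_edges)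
  have small: "card K < v" if K: "K = {y \<in> {0..<n}. reach E x y}" and x: "x \<in> {0..<n}" for K x
  proof (rule ccontr)
    assume "\<not> card K < v"
    then obtain W where W: "W \<subseteq> K" "card W = v" "v \<le> Suc (card (induced_edges E W))"
      using component_grow[OF g x K v] by auto
    then have "W \<subseteq> {0..<n}" using K by auto
    then have "card (induced_edges E W) < v - 1" using tr W(2) by blast
    then show False using W(3) by linarith
  qed
  have nc: "\<not> has_cycle {0..<n} E"
  proof
    assume "has_cycle {0..<n} E"
    then obtain xs where xs: "3 \<le> length xs" "distinct xs" "set xs \<subseteq> {0..<n}"
      and cy: "\<forall>i < length xs. {xs ! i, xs ! ((i + 1) mod length xs)} \<in> E"
      unfolding has_cycle_def by blast
    have r: "reach E (xs ! 0) (xs ! i)" if "i < length xs" for i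
      using that
    proof (induction i)
      case 0 then show ?case by (simp add: reach_def)
    next
      case (Suc i)
      then have "{xs ! i, xs ! Suc i} \<in> E" using cy[rule_format, of i] by simp
      then show ?case using Suc reach_trans[OF _ reach_edge] by simp
    qed
    have x0: "xs ! 0 \<in> {0..<n}" using xs by (meson nth_mem subsetD less_le_trans zero_less_numeral)
    define K where "K = {y \<in> {0..<n}. reach E (xs ! 0) y}"
    have "set xs \<subseteq> K" using xs(3) r by (auto simp: K_def in_set_conv_nth)
    then have "card (set xs) \<le> card K" by (intro card_mono) (auto simp: K_def)
    then have l: "length xs < v" using small[OF K_def x0] xs(2) by (simp add: distinct_card)
    then have "card (induced_edges E (set xs)) < length xs"
      using cyc[rule_format, of "length xs" "set xs"] xs by (simp add: distinct_card)
    then show False using cycle_many_edges[OF xs(1,2) cy] by simp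
  qed
  show ?thesis
    unfolding breaker_wins_game_def
  proof (rule breaker_win_componentwise[OF g gH b C])
    fix K assume "K \<in> components {0..<n} E"
    then obtain x where x: "x \<in> {0..<n}" and K: "K = {y \<in> {0..<n}. reach E x y}"
      by (auto simp: components_def)
    have "tree K (induced_edges E K)" using component_tree[OF g nc x K] .
    then show "\<not> maker_win K (induced_edges E K) C (induced_edges EH C) b True {} {}"
      using min[of K "induced_edges E K"] small[OF K x] by (auto simp: maker_wins_game_def)
  qed
qed

theorem theorem2:
  fixes VH :: "'b set" and EH :: "'b set set" and b :: nat
  assumes "forest VH EH" and "b > 0"
  shows
   "(tree VH EH \<longrightarrow>
       (\<exists>(VT :: nat set) ET. tree VT ET \<and> maker_wins_game VT ET VH EH b True))
    \<and>
    (\<forall>(Tmin :: 'b set \<Rightarrow> nat set \<times> nat set set) C0.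
       EH \<noteq> {} \<and>
       (\<forall>C \<in> components VH EH.
          tree (fst (Tmin C)) (snd (Tmin C)) \<and>
          maker_wins_game (fst (Tmin C)) (snd (Tmin C)) C (induced_edges EH C) b True \<and>
          (\<forall>(VT :: nat set) ET. tree VT ET \<and> maker_wins_game VT ET C (induced_edges EH C) b True
               \<longrightarrow> card (fst (Tmin C)) \<le> card VT)) \<and>
       C0 \<in> components VH EH \<and>
       (\<forall>C \<in> components VH EH. card (fst (Tmin C)) \<le> card (fst (Tmin C0)))
     \<longrightarrow>
       (let v = card (fst (Tmin C0)); e = card (snd (Tmin C0)) in
        \<forall>p :: nat \<Rightarrow> real. (\<forall>n. 0 \<le> p n \<and> p n \<le> 1) \<longrightarrow>
          ((\<lambda>n. real n powr (- real v / real e)) \<in> o(p) \<longrightarrow>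
             (\<forall>mf. whp p (\<lambda>n E. maker_wins_game {0..<n} E VH EH b mf))) \<and>
          (p \<in> o(\<lambda>n. real n powr (- real v / real e)) \<longrightarrow>
             (\<forall>mf. whp p (\<lambda>n E. breaker_wins_game {0..<n} E VH EH b mf)))))"
proof (intro conjI impI allI)
  assume "tree VH EH"
  then show "\<exists>(VT :: nat set) ET. tree VT ET \<and> maker_wins_game VT ET VH EH b True"
    using maker_wins_on_large_tree assms(2) by blast
next
  fix Tmin :: "'b set \<Rightarrow> nat set \<times> nat set set" and C0
  assume a: "EH \<noteq> {} \<and>
       (\<forall>C \<in> components VH EH.
          tree (fst (Tmin C)) (snd (Tmin C)) \<and>
          maker_wins_game (fst (Tmin C)) (snd (Tmin C)) C (induced_edges EH C) b True \<and>
          (\<forall>(VT :: nat set) ET. tree VT ET \<and> maker_wins_game VT ET C (induced_edges EH C) b True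
               \<longrightarrow> card (fst (Tmin C)) \<le> card VT)) \<and>
       C0 \<in> components VH EH \<and>
       (\<forall>C \<in> components VH EH. card (fst (Tmin C)) \<le> card (fst (Tmin C0)))"
  have g: "graph VH EH" using assms(1) by (simp add: forest_def)
  have C0: "C0 \<in> components VH EH" using a by blast
  define v where "v = card (fst (Tmin C0))"
  define e where "e = card (snd (Tmin C0))"
  have T: "tree (fst (Tmin C)) (snd (Tmin C)) \<and>
      maker_wins_game (fst (Tmin C)) (snd (Tmin C)) C (induced_edges EH C) b True \<and> card (fst (Tmin C)) \<le> v"
    if "C \<in> components VH EH" for C using a that by (simp add: v_def)
  have min: "v \<le> card VT" if "tree VT ET" "maker_wins_game VT ET C0 (induced_edges EH C0) b True"
    for VT :: "nat set" and ET using a C0 that unfolding v_def by blast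
  have ve: "v = Suc e" using tree_card_edges[of "fst (Tmin C0)"] T[OF C0] by (simp add: v_def e_def)
  \<comment> \<open>An edge of \<open>EH\<close> lies in some component, perhaps not
    \<open>C0\<close>; a winning board for it has at least two vertices, and \<open>v\<close> is the
    largest of the minimal sizes.\<close>
  have e0: "0 < e"
  proof -
    obtain s where s: "s \<in> EH" using a by blast
    then have "\<exists>x y. x \<noteq> y \<and> x \<in> VH \<and> y \<in> VH \<and> s = {x, y}" using g unfolding graph_def by simp
    then obtain x y where xy: "x \<noteq> y" "x \<in> VH" "y \<in> VH" "{x, y} \<in> EH" using s by auto
    define C where "C = {z \<in> VH. reach EH x z}"
    have C: "C \<in> components VH EH" using xy by (auto simp: C_def components_def)
    have "x \<in> C" "y \<in> C" using xy reach_edge[OF xy(4)] by (auto simp: C_def reach_def)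
    have fin: "finite (fst (Tmin C))" using T[OF C] by (auto simp: tree_def graph_def)
    obtain M f where M: "M \<subseteq> fst (Tmin C)" "inj_on f C" "f ` C \<subseteq> M"
      using maker_win_has_copy[OF T[OF C, THEN conjunct2, THEN conjunct1, unfolded maker_wins_game_def] _ fin]
      unfolding has_copy_def by auto
    have "card {f x, f y} \<le> card (fst (Tmin C))"
      using M \<open>x \<in> C\<close> \<open>y \<in> C\<close> fin by (intro card_mono) auto
    moreover have "f x \<noteq> f y" using M(2) \<open>x \<in> C\<close> \<open>y \<in> C\<close> xy(1) by (auto dest: inj_onD)
    ultimately have "2 \<le> v" using T[OF C] by simp
    then show ?thesis using ve by simp
  qed
  have maker: "whp p (\<lambda>n E. maker_wins_game {0..<n} E VH EH b mf)"
    if p: "\<And>n. 0 \<le> p n \<and> p n \<le> 1" and lim: "(\<lambda>n. real n powr (- real v / real e)) \<in> o(p)" for p mf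
  proof -
    \<comment> \<open>One copy more than Breaker can touch with an opening move and \<open>b\<close>
      vertices in each of at most \<open>v\<close> rounds per component.\<close>
    define N where "N = Suc (b + b * (v * card (components VH EH)))"
    define I where "I = components VH EH \<times> {..<N}"
    define EF where "EF = (\<Union>i\<in>I. (\<lambda>s. Pair i ` s) ` snd (Tmin (fst i)))"
    have finI: "finite I" using g by (simp add: I_def finite_components graph_def)
    have tI: "tree (fst (Tmin (fst i))) (snd (Tmin (fst i))) \<and> card (fst (Tmin (fst i))) \<le> Suc e" if "i \<in> I" for i
      using T[of "fst i"] that by (auto simp: I_def ve)
    have gF: "graph (Sigma I (\<lambda>i. fst (Tmin (fst i)))) EF"
      by (rule small_density_disjoint_trees(1)[OF finI _ EF_def]) (rule tI)
    have dens: "v * card (induced_edges EF S) \<le> e * card S" if "S \<subseteq> Sigma I (\<lambda>i. fst (Tmin (fst i)))" for S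
      unfolding ve by (rule small_density_disjoint_trees(2)[OF finI _ EF_def that]) (rule tI)
    have "whp p (\<lambda>n E. has_copy E (Sigma I (\<lambda>i. fst (Tmin (fst i)))) EF {0..<n})"
      using gF p e0 dens lim by (rule whp_has_copy)
    then show ?thesis
    proof (rule whp_mono)
      fix n :: nat and E assume "has_copy E (Sigma I (\<lambda>i. fst (Tmin (fst i)))) EF {0..<n}"
      then show "maker_wins_game {0..<n} E VH EH b mf"
        unfolding EF_def by (intro maker_wins_of_forest_copy[OF g assms(2) _ T _ I_def]) (auto simp: N_def)
    qed
  qed
  have breaker: "whp p (\<lambda>n E. breaker_wins_game {0..<n} E VH EH b mf)"
    if p: "\<And>n. 0 \<le> p n \<and> p n \<le> 1" and lim: "p \<in> o(\<lambda>n. real n powr (- real v / real e))" for p mf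
  proof -
    have "e \<le> v" by (simp add: ve)
    note L = sparse_limits[OF p e0 this lim]
    \<comment> \<open>For sets of size \<open>v\<close> the forbidden number of edges is
      \<open>v - 1 = e\<close>, matching \<open>n^v * p^e\<close>; for size \<open>l < v\<close> it
      is \<open>l\<close>, matching \<open>n^l * p^l\<close>.\<close>
    have "whp p (\<lambda>n E. (\<forall>W\<subseteq>{0..<n}. card W = v \<longrightarrow> card (induced_edges E W) < v - 1) \<and>
        (\<forall>l\<in>{1..<v}. \<forall>W\<subseteq>{0..<n}. card W = l \<longrightarrow> card (induced_edges E W) < l))"
      using L ve by (intro whp_conj whp_ball whp_no_dense_subset p) auto
    then show ?thesis
    proof (rule whp_mono)
      fix n :: nat and E assume "E \<subseteq> all_edges n" and "(\<forall>W\<subseteq>{0..<n}. card W = v \<longrightarrow> card (induced_edges E W) < v - 1) \<and>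
        (\<forall>l\<in>{1..<v}. \<forall>W\<subseteq>{0..<n}. card W = l \<longrightarrow> card (induced_edges E W) < l)"
      then show "breaker_wins_game {0..<n} E VH EH b mf"
        using min by (intro breaker_wins_of_sparse[OF _ g assms(2) C0, of E n v]) (auto simp: ve)
    qed
  qed
  show "let v = card (fst (Tmin C0)); e = card (snd (Tmin C0)) in
        \<forall>p :: nat \<Rightarrow> real. (\<forall>n. 0 \<le> p n \<and> p n \<le> 1) \<longrightarrow>
          ((\<lambda>n. real n powr (- real v / real e)) \<in> o(p) \<longrightarrow>
             (\<forall>mf. whp p (\<lambda>n E. maker_wins_game {0..<n} E VH EH b mf))) \<and>
          (p \<in> o(\<lambda>n. real n powr (- real v / real e)) \<longrightarrow>
             (\<forall>mf. whp p (\<lambda>n E. breaker_wins_game {0..<n} E VH EH b mf)))"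
    unfolding Let_def v_def[symmetric] e_def[symmetric] using maker breaker by simp
qed

end
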